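(* Let $G$ be a group, let $n\geq1$, and fix a free presentation $c=(F,R)$ of $G$, i.e. an exact sequence $1\to R\to F\to G\to1$ with $F$ a free group. Let $c\sqcup c$ be the coproduct of $c$ with itself in $\mathrm{Pres}(G)$ with the two coproduct inclusions $i_0,i_1:c\to c\sqcup c$, and let $Q_n$ be the functor sending a presentation $(E,S)$ of $G$ to $Q_n(E,S)=E/(S'\gamma_n(E))$. Then $$\frac{D_n(G)}{\gamma_n(G)}\;\cong\;\operatorname{Im}\Bigl(\operatorname{Eq}\bigl(Q_n(i_0),\,Q_n(i_1):Q_n(c)\rightrightarrows Q_n(c\sqcup c)\bigr)\longrightarrow G/\gamma_n(G)\Bigr),$$ where the map to $G/\gamma_n(G)$ is the restriction to the equalizer of the homomorphism $Q_n(c)=F/(R'\gamma_n(F))\to G/\gamma_n(G)$ induced by $F\to G$.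
   Context: For a group $G$: $\mathbb Z[G]$ is the integral group ring, $\mathbf g$ its augmentation ideal, $D_n(G)=\{x\in G:x-1\in\mathbf g^n\}$, and $\gamma_1(G)=G$, $\gamma_{k+1}(G)=[\gamma_k(G),G]$. For a subgroup $S$, $S'=[S,S]$. $\mathrm{Pres}(G)$ is the category of exact sequences $1\to R\to F\to G\to1$ with $F$ free (written $(F,R)$); morphisms are homomorphisms of the free groups commuting with the maps to $G$. The coproduct $c\sqcup c$ of $c=(F,R)$ with itself is the presentation $H=F_0*F_1\to G$, where $F_0,F_1$ are two copies of $F$ and the map restricts to $F\to G$ on each copy, with $S=\ker(H\to G)$; $i_0,i_1:F\to H$ are the inclusions onto the two copies. $\operatorname{Eq}(\alpha,\beta:A\rightrightarrows B)=\{a\in A:\alpha(a)=\beta(a)\}$. *)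

theory Defs
  imports "HOL-Algebra.Generated_Groups" "HOL-Algebra.Ideal_Product" "HOL-Library.Poly_Mapping"
begin

section \<open>Integral group ring and dimension subgroups\<close>

definition group_ring :: "('a, 'm) monoid_scheme \<Rightarrow> ('a \<Rightarrow>\<^sub>0 int) ring" where
  "group_ring G =
    \<lparr>carrier = {c. Poly_Mapping.keys c \<subseteq> carrier G},
     monoid.mult = (\<lambda>a b. \<Sum>x\<in>Poly_Mapping.keys a. \<Sum>y\<in>Poly_Mapping.keys b.
        Poly_Mapping.single (x \<otimes>\<^bsub>G\<^esub> y) (Poly_Mapping.lookup a x * Poly_Mapping.lookup b y)),
     monoid.one = Poly_Mapping.single \<one>\<^bsub>G\<^esub> 1,
     ring.zero = 0,
     ring.add = (+)\<rparr>"

definition augmentation :: "('a \<Rightarrow>\<^sub>0 int) \<Rightarrow> int" where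
  "augmentation c = (\<Sum>x\<in>Poly_Mapping.keys c. Poly_Mapping.lookup c x)"

definition augmentation_ideal :: "('a, 'm) monoid_scheme \<Rightarrow> ('a \<Rightarrow>\<^sub>0 int) set" where
  "augmentation_ideal G = {c \<in> carrier (group_ring G). augmentation c = 0}"

text \<open>The ideals of a ring form a monoid under the ideal product, whose unit is the whole ring;
  the power below is taken there.\<close>

definition dimension_subgroup :: "('a, 'm) monoid_scheme \<Rightarrow> nat \<Rightarrow> 'a set" where
  "dimension_subgroup G n =
    {x \<in> carrier G. Poly_Mapping.single x 1 - Poly_Mapping.single \<one>\<^bsub>G\<^esub> 1
        \<in> augmentation_ideal G [^]\<^bsub>ideals_set (group_ring G)\<^esub> n}"


section \<open>Lower central series\<close>

definition commutator_subgroup :: "('a, 'm) monoid_scheme \<Rightarrow> 'a set \<Rightarrow> 'a set \<Rightarrow> 'a set" where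
  "commutator_subgroup G H K =
    generate G (\<Union>h\<in>H. \<Union>k\<in>K. {h \<otimes>\<^bsub>G\<^esub> k \<otimes>\<^bsub>G\<^esub> inv\<^bsub>G\<^esub> h \<otimes>\<^bsub>G\<^esub> inv\<^bsub>G\<^esub> k})"

text \<open>The series is indexed from 1; the value at 0 is irrelevant.\<close>

fun lower_central :: "('a, 'm) monoid_scheme \<Rightarrow> nat \<Rightarrow> 'a set" where
  "lower_central G 0 = carrier G"
| "lower_central G (Suc 0) = carrier G"
| "lower_central G (Suc (Suc k)) =
     commutator_subgroup G (lower_central G (Suc k)) (carrier G)"


section \<open>Free groups and free presentations\<close>

text \<open>A letter \<open>(True, x)\<close> stands for \<open>x\<close> and \<open>(False, x)\<close> for its inverse.\<close>

definition letter_value :: "('a, 'm) monoid_scheme \<Rightarrow> bool \<times> 'a \<Rightarrow> 'a" where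
  "letter_value F l = (if fst l then snd l else inv\<^bsub>F\<^esub> (snd l))"

definition word_value :: "('a, 'm) monoid_scheme \<Rightarrow> (bool \<times> 'a) list \<Rightarrow> 'a" where
  "word_value F w = foldr (\<lambda>l y. letter_value F l \<otimes>\<^bsub>F\<^esub> y) w \<one>\<^bsub>F\<^esub>"

definition reduced_words :: "'a set \<Rightarrow> (bool \<times> 'a) list set" where
  "reduced_words B =
    {w \<in> lists (UNIV \<times> B). successively (\<lambda>l l'. \<not> (snd l = snd l' \<and> fst l \<noteq> fst l')) w}"

definition free_basis :: "('a, 'm) monoid_scheme \<Rightarrow> 'a set \<Rightarrow> bool" where
  "free_basis F B \<longleftrightarrow>
    B \<subseteq> carrier F \<and> bij_betw (word_value F) (reduced_words B) (carrier F)"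

definition free_group :: "('a, 'm) monoid_scheme \<Rightarrow> bool" where
  "free_group F \<longleftrightarrow> group F \<and> (\<exists>B. free_basis F B)"

text \<open>An exact sequence \<open>1 \<rightarrow> R \<rightarrow> F \<rightarrow> G \<rightarrow> 1\<close> with \<open>R \<rightarrow> F\<close> the inclusion of a subgroup.\<close>

definition free_presentation ::
    "('g, 'm) monoid_scheme \<Rightarrow> ('f, 'k) monoid_scheme \<Rightarrow> 'f set \<Rightarrow> ('f \<Rightarrow> 'g) \<Rightarrow> bool" where
  "free_presentation G F R \<pi> \<longleftrightarrow>
    group G \<and> free_group F \<and> \<pi> \<in> epi F G \<and> R = kernel F G \<pi>"


section \<open>Free products\<close>

definition free_product_words ::
    "('a, 'm) monoid_scheme \<Rightarrow> ('b, 'k) monoid_scheme \<Rightarrow> ('a + 'b) list set" where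
  "free_product_words A B = lists (carrier A <+> carrier B)"

inductive_set free_product_rel ::
    "('a, 'm) monoid_scheme \<Rightarrow> ('b, 'k) monoid_scheme \<Rightarrow> (('a + 'b) list \<times> ('a + 'b) list) set"
  for A B where
  refl: "u \<in> free_product_words A B \<Longrightarrow> (u, u) \<in> free_product_rel A B"
| sym: "(u, v) \<in> free_product_rel A B \<Longrightarrow> (v, u) \<in> free_product_rel A B"
| trans: "\<lbrakk>(u, v) \<in> free_product_rel A B; (v, w) \<in> free_product_rel A B\<rbrakk>
    \<Longrightarrow> (u, w) \<in> free_product_rel A B"
| one_l: "\<lbrakk>u \<in> free_product_words A B; v \<in> free_product_words A B\<rbrakk>
    \<Longrightarrow> (u @ [Inl \<one>\<^bsub>A\<^esub>] @ v, u @ v) \<in> free_product_rel A B"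
| one_r: "\<lbrakk>u \<in> free_product_words A B; v \<in> free_product_words A B\<rbrakk>
    \<Longrightarrow> (u @ [Inr \<one>\<^bsub>B\<^esub>] @ v, u @ v) \<in> free_product_rel A B"
| mult_l: "\<lbrakk>u \<in> free_product_words A B; v \<in> free_product_words A B;
      x \<in> carrier A; y \<in> carrier A\<rbrakk>
    \<Longrightarrow> (u @ [Inl x, Inl y] @ v, u @ [Inl (x \<otimes>\<^bsub>A\<^esub> y)] @ v) \<in> free_product_rel A B"
| mult_r: "\<lbrakk>u \<in> free_product_words A B; v \<in> free_product_words A B;
      x \<in> carrier B; y \<in> carrier B\<rbrakk>
    \<Longrightarrow> (u @ [Inr x, Inr y] @ v, u @ [Inr (x \<otimes>\<^bsub>B\<^esub> y)] @ v) \<in> free_product_rel A B"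

definition free_product ::
    "('a, 'm) monoid_scheme \<Rightarrow> ('b, 'k) monoid_scheme \<Rightarrow> ('a + 'b) list set monoid" where
  "free_product A B =
    \<lparr>carrier = free_product_words A B // free_product_rel A B,
     monoid.mult = (\<lambda>C D. \<Union>u\<in>C. \<Union>v\<in>D. free_product_rel A B `` {u @ v}),
     monoid.one = free_product_rel A B `` {[]}\<rparr>"

definition free_product_inl ::
    "('a, 'm) monoid_scheme \<Rightarrow> ('b, 'k) monoid_scheme \<Rightarrow> 'a \<Rightarrow> ('a + 'b) list set" where
  "free_product_inl A B x = free_product_rel A B `` {[Inl x]}"

definition free_product_inr ::
    "('a, 'm) monoid_scheme \<Rightarrow> ('b, 'k) monoid_scheme \<Rightarrow> 'b \<Rightarrow> ('a + 'b) list set" where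
  "free_product_inr A B y = free_product_rel A B `` {[Inr y]}"

definition sum_word_value ::
    "('c, 'm) monoid_scheme \<Rightarrow> ('a \<Rightarrow> 'c) \<Rightarrow> ('b \<Rightarrow> 'c) \<Rightarrow> ('a + 'b) list \<Rightarrow> 'c" where
  "sum_word_value K f g w = foldr (\<lambda>l z. case_sum f g l \<otimes>\<^bsub>K\<^esub> z) w \<one>\<^bsub>K\<^esub>"

definition free_product_lift ::
    "('c, 'm) monoid_scheme \<Rightarrow> ('a \<Rightarrow> 'c) \<Rightarrow> ('b \<Rightarrow> 'c) \<Rightarrow> ('a + 'b) list set \<Rightarrow> 'c" where
  "free_product_lift K f g C = the_elem (sum_word_value K f g ` C)"

lemma free_product_rel_words:
  assumes "group A" "group B" "(u, v) \<in> free_product_rel A B"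
  shows "u \<in> free_product_words A B \<and> v \<in> free_product_words A B"
proof -
  interpret A: group A by fact
  interpret B: group B by fact
  from assms(3) show ?thesis
    by induct (auto simp: free_product_words_def)
qed

lemma equiv_free_product_rel:
  assumes "group A" "group B"
  shows "equiv (free_product_words A B) (free_product_rel A B)"
proof (rule equivI)
  show "free_product_rel A B \<subseteq> free_product_words A B \<times> free_product_words A B"
    using free_product_rel_words[OF assms] by auto
  show "refl_on (free_product_words A B) (free_product_rel A B)"
    by (rule refl_onI) (rule free_product_rel.refl)
  show "sym (free_product_rel A B)" by (rule symI) (rule free_product_rel.sym)
  show "trans (free_product_rel A B)" by (rule transI) (rule free_product_rel.trans)
qed

lemma free_product_rel_append_right:
  assumes "w \<in> free_product_words A B" "(u, v) \<in> free_product_rel A B"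
  shows "(u @ w, v @ w) \<in> free_product_rel A B"
  using assms(2)
proof induct
  case (refl u)
  then show ?case using assms(1)
    by (auto simp: free_product_words_def intro!: free_product_rel.refl)
next
  case (sym u v)
  then show ?case by (blast intro: free_product_rel.sym)
next
  case (trans u v w)
  then show ?case by (blast intro: free_product_rel.trans)
next
  case (one_l u v)
  with free_product_rel.one_l[of u A B "v @ w"] assms(1) show ?case
    by (simp add: free_product_words_def)
next
  case (one_r u v)
  with free_product_rel.one_r[of u A B "v @ w"] assms(1) show ?case
    by (simp add: free_product_words_def)
next
  case (mult_l u v x y)
  with free_product_rel.mult_l[of u A B "v @ w" x y] assms(1) show ?case
    by (simp add: free_product_words_def)
next
  case (mult_r u v x y)
  with free_product_rel.mult_r[of u A B "v @ w" x y] assms(1) show ?case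
    by (simp add: free_product_words_def)
qed

lemma free_product_rel_append_left:
  assumes "w \<in> free_product_words A B" "(u, v) \<in> free_product_rel A B"
  shows "(w @ u, w @ v) \<in> free_product_rel A B"
  using assms(2)
proof induct
  case (refl u)
  then show ?case using assms(1)
    by (auto simp: free_product_words_def intro!: free_product_rel.refl)
next
  case (sym u v)
  then show ?case by (blast intro: free_product_rel.sym)
next
  case (trans u v w)
  then show ?case by (blast intro: free_product_rel.trans)
next
  case (one_l u v)
  with free_product_rel.one_l[of "w @ u" A B v] assms(1) show ?case
    by (simp add: free_product_words_def)
next
  case (one_r u v)
  with free_product_rel.one_r[of "w @ u" A B v] assms(1) show ?case
    by (simp add: free_product_words_def)
next
  case (mult_l u v x y)
  with free_product_rel.mult_l[of "w @ u" A B v x y] assms(1) show ?case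
    by (simp add: free_product_words_def)
next
  case (mult_r u v x y)
  with free_product_rel.mult_r[of "w @ u" A B v x y] assms(1) show ?case
    by (simp add: free_product_words_def)
qed

lemma free_product_mult_class:
  assumes "group A" "group B" "u \<in> free_product_words A B" "v \<in> free_product_words A B"
  shows "free_product_rel A B `` {u} \<otimes>\<^bsub>free_product A B\<^esub> free_product_rel A B `` {v}
    = free_product_rel A B `` {u @ v}"
proof -
  note E = equiv_free_product_rel[OF assms(1,2)]
  have "free_product_rel A B `` {u' @ v'} = free_product_rel A B `` {u @ v}"
    if "(u, u') \<in> free_product_rel A B" "(v, v') \<in> free_product_rel A B" for u' v'
  proof -
    have u': "u' \<in> free_product_words A B"
      using free_product_rel_words[OF assms(1,2) that(1)] by simp
    have "(u @ v, u' @ v') \<in> free_product_rel A B"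
      using free_product_rel_append_right[OF assms(4) that(1)]
        free_product_rel_append_left[OF u' that(2)] by (rule free_product_rel.trans)
    then show ?thesis using equiv_class_eq[OF E] by blast
  qed
  moreover have "(u, u) \<in> free_product_rel A B" "(v, v) \<in> free_product_rel A B"
    using assms by (auto intro: free_product_rel.refl)
  ultimately have "(\<Union>u'\<in>free_product_rel A B `` {u}. \<Union>v'\<in>free_product_rel A B `` {v}.
      free_product_rel A B `` {u' @ v'}) = free_product_rel A B `` {u @ v}"
    by blast
  then show ?thesis by (simp add: free_product_def)
qed

lemma free_product_inverse_word:
  assumes "group A" "group B" "u \<in> free_product_words A B"
  shows "\<exists>v\<in>free_product_words A B. (v @ u, []) \<in> free_product_rel A B"
  using assms(3)
proof (induct u)
  case Nil
  then show ?case by (auto intro: free_product_rel.refl)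
next
  case (Cons l u)
  interpret A: group A by fact
  interpret B: group B by fact
  from Cons obtain v where v: "v \<in> free_product_words A B" "(v @ u, []) \<in> free_product_rel A B"
    by (auto simp: free_product_words_def)
  have u: "u \<in> free_product_words A B" using Cons.prems by (auto simp: free_product_words_def)
  have "\<exists>l'. [l'] \<in> free_product_words A B \<and> (v @ [l', l] @ u, v @ u) \<in> free_product_rel A B"
  proof (cases l)
    case (Inl x)
    then have x: "x \<in> carrier A" using Cons.prems by (auto simp: free_product_words_def)
    have "(v @ [Inl (inv\<^bsub>A\<^esub> x), Inl x] @ u, v @ u) \<in> free_product_rel A B"
      using free_product_rel.mult_l[OF v(1) u A.inv_closed[OF x] x]
        free_product_rel.one_l[OF v(1) u] x
      by (auto intro: free_product_rel.trans)
    then show ?thesis using Inl x by (auto simp: free_product_words_def)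
  next
    case (Inr x)
    then have x: "x \<in> carrier B" using Cons.prems by (auto simp: free_product_words_def)
    have "(v @ [Inr (inv\<^bsub>B\<^esub> x), Inr x] @ u, v @ u) \<in> free_product_rel A B"
      using free_product_rel.mult_r[OF v(1) u B.inv_closed[OF x] x]
        free_product_rel.one_r[OF v(1) u] x
      by (auto intro: free_product_rel.trans)
    then show ?thesis using Inr x by (auto simp: free_product_words_def)
  qed
  then obtain l' where l': "[l'] \<in> free_product_words A B"
    "(v @ [l', l] @ u, v @ u) \<in> free_product_rel A B" by blast
  have "((v @ [l']) @ l # u, []) \<in> free_product_rel A B"
    using free_product_rel.trans[OF l'(2) v(2)] by simp
  moreover have "v @ [l'] \<in> free_product_words A B"
    using v(1) l'(1) by (auto simp: free_product_words_def)
  ultimately show ?case by blast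
qed

lemma group_free_product:
  assumes "group A" "group B"
  shows "group (free_product A B)"
proof -
  note E = equiv_free_product_rel[OF assms] and M = free_product_mult_class[OF assms]
  have nil: "[] \<in> free_product_words A B" by (simp add: free_product_words_def)
  have app: "u @ v \<in> free_product_words A B"
    if "u \<in> free_product_words A B" "v \<in> free_product_words A B" for u v
    using that by (simp add: free_product_words_def)
  have car: "carrier (free_product A B) = free_product_words A B // free_product_rel A B"
    and one: "\<one>\<^bsub>free_product A B\<^esub> = free_product_rel A B `` {[]}"
    by (simp_all add: free_product_def)
  show ?thesis
  proof (rule groupI)
    fix x y assume "x \<in> carrier (free_product A B)" "y \<in> carrier (free_product A B)"
    then show "x \<otimes>\<^bsub>free_product A B\<^esub> y \<in> carrier (free_product A B)"
      unfolding car by (auto elim!: quotientE simp: M intro!: quotientI app)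
  next
    show "\<one>\<^bsub>free_product A B\<^esub> \<in> carrier (free_product A B)"
      unfolding car one by (rule quotientI[OF nil])
  next
    fix x y z assume "x \<in> carrier (free_product A B)" "y \<in> carrier (free_product A B)"
      "z \<in> carrier (free_product A B)"
    then show "x \<otimes>\<^bsub>free_product A B\<^esub> y \<otimes>\<^bsub>free_product A B\<^esub> z =
        x \<otimes>\<^bsub>free_product A B\<^esub> (y \<otimes>\<^bsub>free_product A B\<^esub> z)"
      unfolding car by (auto elim!: quotientE simp: M app)
  next
    fix x assume "x \<in> carrier (free_product A B)"
    then show "\<one>\<^bsub>free_product A B\<^esub> \<otimes>\<^bsub>free_product A B\<^esub> x = x"
      unfolding car one by (auto elim!: quotientE simp: M nil)
  next
    fix x assume "x \<in> carrier (free_product A B)"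
    then obtain u where u: "u \<in> free_product_words A B" "x = free_product_rel A B `` {u}"
      unfolding car by (auto elim: quotientE)
    obtain v where v: "v \<in> free_product_words A B" "(v @ u, []) \<in> free_product_rel A B"
      using free_product_inverse_word[OF assms u(1)] by blast
    then show "\<exists>y\<in>carrier (free_product A B). y \<otimes>\<^bsub>free_product A B\<^esub> x = \<one>\<^bsub>free_product A B\<^esub>"
      unfolding car one u(2)
      by (intro bexI[of _ "free_product_rel A B `` {v}"] quotientI)
        (simp_all add: M u(1) equiv_class_eq[OF E])
  qed
qed

lemma free_product_inl_hom:
  assumes "group A" "group B"
  shows "free_product_inl A B \<in> hom A (free_product A B)"
proof (rule homI)
  fix x assume "x \<in> carrier A"
  then show "free_product_inl A B x \<in> carrier (free_product A B)"
    by (auto simp: free_product_inl_def free_product_def free_product_words_def intro!: quotientI)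
next
  fix x y assume x: "x \<in> carrier A" and y: "y \<in> carrier A"
  then have "([Inl x, Inl y], [Inl (x \<otimes>\<^bsub>A\<^esub> y)]) \<in> free_product_rel A B"
    using free_product_rel.mult_l[of "[]" A B "[]" x y] by (simp add: free_product_words_def)
  then have "free_product_rel A B `` {[Inl x, Inl y]} = free_product_rel A B `` {[Inl (x \<otimes>\<^bsub>A\<^esub> y)]}"
    by (rule equiv_class_eq[OF equiv_free_product_rel[OF assms]])
  moreover have "[Inl x] \<in> free_product_words A B" "[Inl y] \<in> free_product_words A B"
    using x y by (auto simp: free_product_words_def)
  ultimately show "free_product_inl A B (x \<otimes>\<^bsub>A\<^esub> y)
      = free_product_inl A B x \<otimes>\<^bsub>free_product A B\<^esub> free_product_inl A B y"
    by (simp add: free_product_inl_def free_product_mult_class[OF assms])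
qed

lemma free_product_inr_hom:
  assumes "group A" "group B"
  shows "free_product_inr A B \<in> hom B (free_product A B)"
proof (rule homI)
  fix x assume "x \<in> carrier B"
  then show "free_product_inr A B x \<in> carrier (free_product A B)"
    by (auto simp: free_product_inr_def free_product_def free_product_words_def intro!: quotientI)
next
  fix x y assume x: "x \<in> carrier B" and y: "y \<in> carrier B"
  then have "([Inr x, Inr y], [Inr (x \<otimes>\<^bsub>B\<^esub> y)]) \<in> free_product_rel A B"
    using free_product_rel.mult_r[of "[]" A B "[]" x y] by (simp add: free_product_words_def)
  then have "free_product_rel A B `` {[Inr x, Inr y]} = free_product_rel A B `` {[Inr (x \<otimes>\<^bsub>B\<^esub> y)]}"
    by (rule equiv_class_eq[OF equiv_free_product_rel[OF assms]])
  moreover have "[Inr x] \<in> free_product_words A B" "[Inr y] \<in> free_product_words A B"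
    using x y by (auto simp: free_product_words_def)
  ultimately show "free_product_inr A B (x \<otimes>\<^bsub>B\<^esub> y)
      = free_product_inr A B x \<otimes>\<^bsub>free_product A B\<^esub> free_product_inr A B y"
    by (simp add: free_product_inr_def free_product_mult_class[OF assms])
qed

context
  fixes A :: "('a, 'm) monoid_scheme" and B :: "('b, 'k) monoid_scheme"
    and K :: "('c, 'l) monoid_scheme" and f :: "'a \<Rightarrow> 'c" and g :: "'b \<Rightarrow> 'c"
  assumes A: "group A" and B: "group B" and K: "group K"
    and f: "f \<in> hom A K" and g: "g \<in> hom B K"
begin

interpretation K: group K by (rule K)

lemma sum_word_value_closed:
  "u \<in> free_product_words A B \<Longrightarrow> sum_word_value K f g u \<in> carrier K"
  unfolding free_product_words_def
proof (induct u)
  case (Cons l u)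
  then have "case_sum f g l \<in> carrier K"
    by (cases l) (auto simp: hom_in_carrier[OF f] hom_in_carrier[OF g])
  with Cons show ?case by (simp add: sum_word_value_def)
qed (simp add: sum_word_value_def)

lemma sum_word_value_append:
  "\<lbrakk>u \<in> free_product_words A B; v \<in> free_product_words A B\<rbrakk> \<Longrightarrow>
    sum_word_value K f g (u @ v) = sum_word_value K f g u \<otimes>\<^bsub>K\<^esub> sum_word_value K f g v"
proof (induct u)
  case Nil
  then show ?case using sum_word_value_closed[of v] by (simp add: sum_word_value_def)
next
  case (Cons l u)
  have u: "u \<in> free_product_words A B" and l: "[l] \<in> free_product_words A B"
    using Cons.prems by (auto simp: free_product_words_def)
  have "case_sum f g l \<in> carrier K"
    using l f g by (auto simp: free_product_words_def hom_def)
  then show ?case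
    using Cons.hyps[OF u Cons.prems(2)] sum_word_value_closed[OF u]
      sum_word_value_closed[OF Cons.prems(2)]
    by (simp add: sum_word_value_def K.m_assoc)
qed

lemma sum_word_value_rel:
  "(u, v) \<in> free_product_rel A B \<Longrightarrow> sum_word_value K f g u = sum_word_value K f g v"
proof (induct rule: free_product_rel.induct)
  case (one_l u v)
  have "[Inl \<one>\<^bsub>A\<^esub>] \<in> free_product_words A B"
    using group.is_monoid[OF A] by (auto simp: free_product_words_def monoid.one_closed)
  moreover have "sum_word_value K f g [Inl \<one>\<^bsub>A\<^esub>] = \<one>\<^bsub>K\<^esub>"
    using hom_one[OF f A K] by (simp add: sum_word_value_def)
  moreover have "[Inl \<one>\<^bsub>A\<^esub>] @ v \<in> free_product_words A B"
    using calculation(1) one_l by (auto simp: free_product_words_def)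
  ultimately show ?case using one_l
    by (simp add: sum_word_value_append sum_word_value_closed del: append_Cons)
next
  case (one_r u v)
  have "[Inr \<one>\<^bsub>B\<^esub>] \<in> free_product_words A B"
    using group.is_monoid[OF B] by (auto simp: free_product_words_def monoid.one_closed)
  moreover have "sum_word_value K f g [Inr \<one>\<^bsub>B\<^esub>] = \<one>\<^bsub>K\<^esub>"
    using hom_one[OF g B K] by (simp add: sum_word_value_def)
  moreover have "[Inr \<one>\<^bsub>B\<^esub>] @ v \<in> free_product_words A B"
    using calculation(1) one_r by (auto simp: free_product_words_def)
  ultimately show ?case using one_r
    by (simp add: sum_word_value_append sum_word_value_closed del: append_Cons)
next
  case (mult_l u v x y)
  have w: "[Inl x, Inl y] \<in> free_product_words A B" "[Inl (x \<otimes>\<^bsub>A\<^esub> y)] \<in> free_product_words A B"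
    using mult_l A by (auto simp: free_product_words_def group.is_monoid monoid.m_closed)
  moreover have "sum_word_value K f g [Inl x, Inl y] = sum_word_value K f g [Inl (x \<otimes>\<^bsub>A\<^esub> y)]"
    using mult_l f by (auto simp: sum_word_value_def hom_def Pi_def K.m_assoc)
  moreover have "[Inl x, Inl y] @ v \<in> free_product_words A B"
    "[Inl (x \<otimes>\<^bsub>A\<^esub> y)] @ v \<in> free_product_words A B"
    using w mult_l by (auto simp: free_product_words_def)
  ultimately show ?case using mult_l
    by (simp add: sum_word_value_append del: append_Cons)
next
  case (mult_r u v x y)
  have w: "[Inr x, Inr y] \<in> free_product_words A B" "[Inr (x \<otimes>\<^bsub>B\<^esub> y)] \<in> free_product_words A B"
    using mult_r B by (auto simp: free_product_words_def group.is_monoid monoid.m_closed)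
  moreover have "sum_word_value K f g [Inr x, Inr y] = sum_word_value K f g [Inr (x \<otimes>\<^bsub>B\<^esub> y)]"
    using mult_r g by (auto simp: sum_word_value_def hom_def Pi_def K.m_assoc)
  moreover have "[Inr x, Inr y] @ v \<in> free_product_words A B"
    "[Inr (x \<otimes>\<^bsub>B\<^esub> y)] @ v \<in> free_product_words A B"
    using w mult_r by (auto simp: free_product_words_def)
  ultimately show ?case using mult_r
    by (simp add: sum_word_value_append del: append_Cons)
qed simp_all

lemma free_product_lift_class:
  assumes "u \<in> free_product_words A B"
  shows "free_product_lift K f g (free_product_rel A B `` {u}) = sum_word_value K f g u"
proof -
  have "sum_word_value K f g ` (free_product_rel A B `` {u}) = {sum_word_value K f g u}"
  proof (rule antisym)
    show "sum_word_value K f g ` (free_product_rel A B `` {u}) \<subseteq> {sum_word_value K f g u}"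
      by (auto dest: sum_word_value_rel)
    show "{sum_word_value K f g u} \<subseteq> sum_word_value K f g ` (free_product_rel A B `` {u})"
      using free_product_rel.refl[OF assms] by blast
  qed
  then show ?thesis by (simp add: free_product_lift_def)
qed

lemma free_product_lift_hom: "free_product_lift K f g \<in> hom (free_product A B) K"
proof (rule homI)
  fix x assume "x \<in> carrier (free_product A B)"
  then show "free_product_lift K f g x \<in> carrier K"
    by (auto simp: free_product_def free_product_lift_class sum_word_value_closed elim!: quotientE)
next
  fix x y assume "x \<in> carrier (free_product A B)" "y \<in> carrier (free_product A B)"
  then obtain u v where "u \<in> free_product_words A B" "x = free_product_rel A B `` {u}"
    "v \<in> free_product_words A B" "y = free_product_rel A B `` {v}"
    by (auto simp: free_product_def elim!: quotientE)
  moreover from this have "u @ v \<in> free_product_words A B" by (simp add: free_product_words_def)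
  ultimately show "free_product_lift K f g (x \<otimes>\<^bsub>free_product A B\<^esub> y)
      = free_product_lift K f g x \<otimes>\<^bsub>K\<^esub> free_product_lift K f g y"
    by (simp add: free_product_mult_class[OF A B] free_product_lift_class sum_word_value_append)
qed

lemma free_product_lift_inl:
  "x \<in> carrier A \<Longrightarrow> free_product_lift K f g (free_product_inl A B x) = f x"
  using hom_in_carrier[OF f] free_product_lift_class[of "[Inl x]"]
  by (simp add: free_product_inl_def free_product_words_def sum_word_value_def InlI)

lemma free_product_lift_inr:
  "y \<in> carrier B \<Longrightarrow> free_product_lift K f g (free_product_inr A B y) = g y"
  using hom_in_carrier[OF g] free_product_lift_class[of "[Inr y]"]
  by (simp add: free_product_inr_def free_product_words_def sum_word_value_def InrI)

lemma free_product_lift_unique: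
  assumes h: "h \<in> hom (free_product A B) K"
    and hl: "\<And>x. x \<in> carrier A \<Longrightarrow> h (free_product_inl A B x) = f x"
    and hr: "\<And>y. y \<in> carrier B \<Longrightarrow> h (free_product_inr A B y) = g y"
    and C: "C \<in> carrier (free_product A B)"
  shows "h C = free_product_lift K f g C"
proof -
  have "h (free_product_rel A B `` {u}) = sum_word_value K f g u"
    if "u \<in> free_product_words A B" for u
    using that
  proof (induct u)
    case Nil
    then show ?case
      using hom_one[OF h group_free_product[OF A B] K]
      by (simp add: free_product_def sum_word_value_def)
  next
    case (Cons l u)
    have u: "u \<in> free_product_words A B" and l: "[l] \<in> free_product_words A B"
      using Cons.prems by (auto simp: free_product_words_def)
    have "h (free_product_rel A B `` {l # u})
        = h (free_product_rel A B `` {[l]} \<otimes>\<^bsub>free_product A B\<^esub> free_product_rel A B `` {u})"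
      using free_product_mult_class[OF A B l u] by simp
    also have "\<dots> = h (free_product_rel A B `` {[l]}) \<otimes>\<^bsub>K\<^esub> h (free_product_rel A B `` {u})"
      using h u l by (intro hom_mult[OF h]) (auto simp: free_product_def intro!: quotientI)
    also have "h (free_product_rel A B `` {[l]}) = case_sum f g l"
      using l hl hr
      by (auto simp: free_product_words_def free_product_inl_def free_product_inr_def)
    finally show ?case using Cons.hyps[OF u] by (simp add: sum_word_value_def)
  qed
  then show ?thesis
    using C by (auto simp: free_product_def free_product_lift_class elim!: quotientE)
qed

end


section \<open>Induced maps on quotients and the functor \<open>Q\<^sub>n\<close>\<close>

text \<open>If \<open>f\<close> is a homomorphism into \<open>H\<close> mapping \<open>M\<close> into the normal subgroup \<open>N\<close>, then
  \<open>N <#> f ` (M #> x) = N #> f x\<close>; so this is the homomorphism induced by \<open>f\<close> on the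
  quotients by \<open>M\<close> and \<open>N\<close>.\<close>

definition quotient_map :: "('b, 'm) monoid_scheme \<Rightarrow> 'b set \<Rightarrow> ('a \<Rightarrow> 'b) \<Rightarrow> 'a set \<Rightarrow> 'b set" where
  "quotient_map H N f C = N <#>\<^bsub>H\<^esub> (f ` C)"

definition Q_subgroup :: "nat \<Rightarrow> ('a, 'm) monoid_scheme \<Rightarrow> 'a set \<Rightarrow> 'a set" where
  "Q_subgroup n E S = derived E S <#>\<^bsub>E\<^esub> lower_central E n"

definition Q_group :: "nat \<Rightarrow> ('a, 'm) monoid_scheme \<Rightarrow> 'a set \<Rightarrow> 'a set monoid" where
  "Q_group n E S = E Mod Q_subgroup n E S"

definition Q_map ::
    "nat \<Rightarrow> ('b, 'm) monoid_scheme \<Rightarrow> 'b set \<Rightarrow> ('a \<Rightarrow> 'b) \<Rightarrow> 'a set \<Rightarrow> 'b set" where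
  "Q_map n E S f = quotient_map E (Q_subgroup n E S) f"

definition equalizer :: "('a, 'm) monoid_scheme \<Rightarrow> ('a \<Rightarrow> 'b) \<Rightarrow> ('a \<Rightarrow> 'b) \<Rightarrow> 'a set" where
  "equalizer A \<alpha> \<beta> = {a \<in> carrier A. \<alpha> a = \<beta> a}"

end

theory Submission
  imports Defs "HOL-Algebra.Free_Abelian_Groups" "HOL-Algebra.SndIsomorphismGrp"
begin

text \<open>
  Write \<open>\<g>\<close> for the augmentation ideal of \<open>\<int>[G]\<close>, \<open>i, j : F \<rightarrow> H\<close> for the two coproduct inclusions and
  \<open>S\<close> for the kernel of \<open>H \<rightarrow> G\<close>. Both inclusions of the theorem come from derivations (with respect to
  right actions).

  If \<open>i x\<close> and \<open>j x\<close> agree modulo \<open>S' \<gamma>\<^sub>n(H)\<close>, consider the derivation \<open>H \<rightarrow> \<g>\<close> that is \<open>\<pi> x - 1\<close> on \<open>i x\<close>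
  and \<open>0\<close> on \<open>j x\<close>. It kills \<open>S'\<close> and maps \<open>\<gamma>\<^sub>n(H)\<close> into \<open>\<g>\<^sup>n\<close>, hence \<open>\<pi> x - 1 \<in> \<g>\<^sup>n\<close>.

  Conversely, \<open>x \<mapsto> (j x)\<inverse> (i x)\<close> is a derivation \<open>D : F \<rightarrow> S/S'\<close>, where \<open>G\<close> acts by conjugation.
  Modulo \<open>D(R)\<close> it factors through \<open>G\<close> and extends additively to \<open>\<int>[G]\<close>; the extension is linear on
  \<open>\<g>\<close>, so it maps \<open>\<g>\<^sup>n\<close> into the image of \<open>S \<inter> \<gamma>\<^sub>n(H)\<close>. Thus for \<open>\<pi> x \<in> D\<^sub>n(G)\<close> there is \<open>r \<in> R\<close> with
  \<open>D(x) \<in> D(r) \<gamma>\<^sub>n(H)\<close>, and \<open>x r\<inverse>\<close> represents an element of the equalizer over \<open>\<pi> x\<close>.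
\<close>

section \<open>Integral group rings and powers of the augmentation ideal\<close>

text \<open>Allows the augmentations of two elements to be summed over one finite set, such as the
  union of their supports.\<close>

lemma augmentation_eq_sum:
  assumes "finite X" "Poly_Mapping.keys c \<subseteq> X"
  shows "augmentation c = (\<Sum>x\<in>X. Poly_Mapping.lookup c x)"
  unfolding augmentation_def
  by (rule sum.mono_neutral_left) (use assms in \<open>auto simp: in_keys_iff\<close>)

lemma augmentation_zero [simp]: "augmentation 0 = 0"
  by (simp add: augmentation_def)

lemma augmentation_frag_of [simp]: "augmentation (frag_of x) = 1"
  by (simp add: augmentation_def)

lemma augmentation_diff [simp]: "augmentation (a - b) = augmentation a - augmentation b"
proof -
  let ?X = "Poly_Mapping.keys a \<union> Poly_Mapping.keys b"
  have "augmentation (a - b) = (\<Sum>x\<in>?X. Poly_Mapping.lookup (a - b) x)"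
    using keys_diff[of a b] by (intro augmentation_eq_sum) auto
  also have "\<dots> = augmentation a - augmentation b"
    by (simp add: augmentation_eq_sum[of ?X] lookup_minus sum_subtractf)
  finally show ?thesis .
qed

lemma augmentation_add [simp]: "augmentation (a + b) = augmentation a + augmentation b"
  using augmentation_diff[of "a + b" b] by simp

section \<open>The ring structure of the integral group ring\<close>

lemma carrier_group_ring [simp]:
    "a \<in> carrier (group_ring G) \<longleftrightarrow> Poly_Mapping.keys a \<subseteq> carrier G"
  and one_group_ring [simp]: "\<one>\<^bsub>group_ring G\<^esub> = frag_of \<one>\<^bsub>G\<^esub>"
  and zero_group_ring [simp]: "\<zero>\<^bsub>group_ring G\<^esub> = 0"
  and add_group_ring [simp]: "a \<oplus>\<^bsub>group_ring G\<^esub> b = a + b"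
  by (simp_all add: group_ring_def)

text \<open>Elements of the group ring are also elements of a free abelian group, and
  \<open>frag_extend\<close> is additive extension from generators. In this form the product is
  visibly additive, and identities can be checked on generators by
  \<open>frag_induction\<close>.\<close>

lemma group_ring_mult_eq_frag_extend:
  "a \<otimes>\<^bsub>group_ring G\<^esub> b = frag_extend (\<lambda>x. frag_extend (\<lambda>y. frag_of (x \<otimes>\<^bsub>G\<^esub> y)) b) a"
proof -
  have "Poly_Mapping.single z (c * d) = frag_cmul c (frag_cmul d (frag_of z))" for z :: 'a and c d
    by (rule poly_mapping_eqI) (simp add: lookup_single when_def)
  then show ?thesis
    by (simp add: group_ring_def frag_extend_def frag_cmul_sum)
qed

lemma group_ring_mult_of_of [simp]:
  "frag_of x \<otimes>\<^bsub>group_ring G\<^esub> frag_of y = frag_of (x \<otimes>\<^bsub>G\<^esub> y)"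
  by (simp add: group_ring_mult_eq_frag_extend)

text \<open>Differences come before sums because \<open>frag_induction\<close> has the cases zero,
  generator and difference; the rules for sums then follow from (a + b) - b = a.\<close>

lemma group_ring_mult_diff_left:
  "(a - b) \<otimes>\<^bsub>group_ring G\<^esub> c = a \<otimes>\<^bsub>group_ring G\<^esub> c - b \<otimes>\<^bsub>group_ring G\<^esub> c"
  by (simp add: group_ring_mult_eq_frag_extend frag_extend_diff)

lemma group_ring_mult_diff_right:
  "a \<otimes>\<^bsub>group_ring G\<^esub> (b - c) = a \<otimes>\<^bsub>group_ring G\<^esub> b - a \<otimes>\<^bsub>group_ring G\<^esub> c"
proof (induction a rule: frag_induction[OF subset_UNIV, case_names zero one diff])
  case (diff a a')
  then show ?case by (simp add: group_ring_mult_diff_left)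
qed (simp_all add: group_ring_mult_eq_frag_extend frag_extend_diff)

lemma group_ring_mult_zero [simp]:
  "0 \<otimes>\<^bsub>group_ring G\<^esub> a = 0" "a \<otimes>\<^bsub>group_ring G\<^esub> 0 = 0"
  using group_ring_mult_diff_left[of G 0 0] group_ring_mult_diff_right[of G _ 0 0] by simp_all

lemma group_ring_mult_add_left:
  "(a + b) \<otimes>\<^bsub>group_ring G\<^esub> c = a \<otimes>\<^bsub>group_ring G\<^esub> c + b \<otimes>\<^bsub>group_ring G\<^esub> c"
  using group_ring_mult_diff_left[of G "a + b" b c] by simp

lemma group_ring_mult_add_right:
  "a \<otimes>\<^bsub>group_ring G\<^esub> (b + c) = a \<otimes>\<^bsub>group_ring G\<^esub> b + a \<otimes>\<^bsub>group_ring G\<^esub> c"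
  using group_ring_mult_diff_right[of G a "b + c" c] by simp

lemma augmentation_mult [simp]:
  "augmentation (a \<otimes>\<^bsub>group_ring G\<^esub> b) = augmentation a * augmentation b"
proof -
  have *: "augmentation (frag_of x \<otimes>\<^bsub>group_ring G\<^esub> b) = augmentation b" for x
    by (induction b rule: frag_induction[OF subset_UNIV, case_names zero one diff]) (simp_all add: group_ring_mult_diff_right)
  show ?thesis
    by (induction a rule: frag_induction[OF subset_UNIV, case_names zero one diff])
      (simp_all add: group_ring_mult_diff_left * algebra_simps)
qed

context group
begin

lemma group_ring_mult_closed:
  assumes "Poly_Mapping.keys a \<subseteq> carrier G" "Poly_Mapping.keys b \<subseteq> carrier G"
  shows "Poly_Mapping.keys (a \<otimes>\<^bsub>group_ring G\<^esub> b) \<subseteq> carrier G"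
proof -
  have "Poly_Mapping.keys (frag_extend (\<lambda>y. frag_of (x \<otimes> y)) b) \<subseteq> carrier G"
    if "x \<in> Poly_Mapping.keys a" for x
    using that assms by (intro order_trans[OF keys_frag_extend]) auto
  then show ?thesis
    unfolding group_ring_mult_eq_frag_extend by (intro order_trans[OF keys_frag_extend]) auto
qed

text \<open>Both sides are additive in each variable, so generators in the carrier suffice. The
  variables are reduced to generators one at a time: \<open>1\<close> treats \<open>c\<close>,
  \<open>2\<close> treats \<open>b\<close>, and the last induction treats \<open>a\<close>.\<close>

lemma group_ring_mult_assoc:
  assumes "Poly_Mapping.keys a \<subseteq> carrier G" "Poly_Mapping.keys b \<subseteq> carrier G"
    "Poly_Mapping.keys c \<subseteq> carrier G"
  shows "(a \<otimes>\<^bsub>group_ring G\<^esub> b) \<otimes>\<^bsub>group_ring G\<^esub> c = a \<otimes>\<^bsub>group_ring G\<^esub> (b \<otimes>\<^bsub>group_ring G\<^esub> c)"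
proof -
  have 1: "(frag_of x \<otimes>\<^bsub>group_ring G\<^esub> frag_of y) \<otimes>\<^bsub>group_ring G\<^esub> c
      = frag_of x \<otimes>\<^bsub>group_ring G\<^esub> (frag_of y \<otimes>\<^bsub>group_ring G\<^esub> c)"
    if "x \<in> carrier G" "y \<in> carrier G" for x y
    using assms(3) by (induction c rule: frag_induction)
      (use that in \<open>simp_all add: group_ring_mult_diff_right m_assoc\<close>)
  have 2: "(frag_of x \<otimes>\<^bsub>group_ring G\<^esub> b) \<otimes>\<^bsub>group_ring G\<^esub> c
      = frag_of x \<otimes>\<^bsub>group_ring G\<^esub> (b \<otimes>\<^bsub>group_ring G\<^esub> c)"
    if "x \<in> carrier G" for x
    using assms(2) by (induction b rule: frag_induction)
      (use that 1 in \<open>simp_all add: group_ring_mult_diff_left group_ring_mult_diff_right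
        del: group_ring_mult_of_of\<close>)
  show ?thesis
    using assms(1) by (induction a rule: frag_induction)
      (use 2 in \<open>simp_all add: group_ring_mult_diff_left\<close>)
qed

lemma group_ring_mult_one:
  assumes "Poly_Mapping.keys a \<subseteq> carrier G"
  shows "frag_of \<one> \<otimes>\<^bsub>group_ring G\<^esub> a = a" "a \<otimes>\<^bsub>group_ring G\<^esub> frag_of \<one> = a"
  using assms by (induction a rule: frag_induction)
    (simp_all add: group_ring_mult_diff_left group_ring_mult_diff_right)

lemma ring_group_ring: "ring (group_ring G)"
proof (rule ringI)
  show "abelian_group (group_ring G)"
  proof (rule abelian_groupI)
    fix x assume "x \<in> carrier (group_ring G)"
    then show "\<exists>y\<in>carrier (group_ring G). y \<oplus>\<^bsub>group_ring G\<^esub> x = \<zero>\<^bsub>group_ring G\<^esub>"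
      by (intro bexI[of _ "- x"]) auto
  qed (simp_all add: order_trans[OF keys_add] add_ac)
  show "monoid (group_ring G)"
    by (rule monoidI) (simp_all add: group_ring_mult_closed group_ring_mult_assoc group_ring_mult_one)
qed (simp_all add: group_ring_mult_add_left group_ring_mult_add_right)

interpretation group_ring: ring "group_ring G"
  by (rule ring_group_ring)

lemma minus_group_ring [simp]:
  "Poly_Mapping.keys a \<subseteq> carrier G \<Longrightarrow> \<ominus>\<^bsub>group_ring G\<^esub> a = - a"
  by (rule group_ring.minus_equality) simp_all

lemma augmentation_ideal_iff:
  "a \<in> augmentation_ideal G \<longleftrightarrow> Poly_Mapping.keys a \<subseteq> carrier G \<and> augmentation a = 0"
  by (simp add: augmentation_ideal_def)

lemma ideal_augmentation_ideal: "ideal (augmentation_ideal G) (group_ring G)"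
proof (rule idealI[OF ring_group_ring])
  show "subgroup (augmentation_ideal G) (add_monoid (group_ring G))"
  proof
    fix x assume x: "x \<in> augmentation_ideal G"
    then have "inv\<^bsub>add_monoid (group_ring G)\<^esub> x = - x"
      using minus_group_ring[of x] by (simp add: a_inv_def augmentation_ideal_iff)
    then show "inv\<^bsub>add_monoid (group_ring G)\<^esub> x \<in> augmentation_ideal G"
      using x augmentation_diff[of 0 x] by (simp add: augmentation_ideal_iff)
  qed (auto simp: augmentation_ideal_iff order_trans[OF keys_add])
qed (simp_all add: augmentation_ideal_iff group_ring_mult_closed)

section \<open>Powers of the augmentation ideal\<close>

abbreviation augmentation_power :: "nat \<Rightarrow> ('a \<Rightarrow>\<^sub>0 int) set" where
  "augmentation_power k \<equiv> augmentation_ideal G [^]\<^bsub>ideals_set (group_ring G)\<^esub> k"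

lemma augmentation_power_0: "augmentation_power 0 = carrier (group_ring G)"
  by (simp add: nat_pow_def ideals_set_def)

lemma augmentation_power_Suc:
  "augmentation_power (Suc k) = augmentation_power k \<cdot>\<^bsub>group_ring G\<^esub> augmentation_ideal G"
  by (simp add: nat_pow_def ideals_set_def)

lemma ideal_augmentation_power: "ideal (augmentation_power k) (group_ring G)"
proof (induction k)
  case 0
  show ?case unfolding augmentation_power_0 by (rule group_ring.oneideal)
next
  case (Suc k)
  then show ?case
    unfolding augmentation_power_Suc
    by (rule group_ring.ideal_prod_is_ideal[OF _ ideal_augmentation_ideal])
qed

lemma augmentation_power_carrier:
  "a \<in> augmentation_power k \<Longrightarrow> Poly_Mapping.keys a \<subseteq> carrier G"
  using ideal.Icarr[OF ideal_augmentation_power] by simp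

lemma augmentation_power_Suc_subset: "augmentation_power (Suc k) \<subseteq> augmentation_ideal G"
  unfolding augmentation_power_Suc
  using group_ring.ideal_prod_inter[OF ideal_augmentation_power ideal_augmentation_ideal] by blast

lemma augmentation_power_1: "augmentation_power (Suc 0) = augmentation_ideal G"
proof
  show "augmentation_ideal G \<subseteq> augmentation_power (Suc 0)"
  proof
    fix a assume a: "a \<in> augmentation_ideal G"
    \<comment> \<open>The power with exponent 0 is the whole ring, so it contains the unit, and
      \<open>a\<close> is the unit times \<open>a\<close>.\<close>
    have "frag_of \<one> \<otimes>\<^bsub>group_ring G\<^esub> a \<in> augmentation_power (Suc 0)"
      unfolding augmentation_power_Suc augmentation_power_0 by (rule ideal_prod.prod) (simp_all add: a)
    then show "a \<in> augmentation_power (Suc 0)"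
      using a by (simp add: group_ring_mult_one augmentation_ideal_iff)
  qed
qed (rule augmentation_power_Suc_subset)

lemma augmentation_power_mult_right:
  "\<lbrakk>a \<in> augmentation_power k; b \<in> augmentation_ideal G\<rbrakk>
    \<Longrightarrow> a \<otimes>\<^bsub>group_ring G\<^esub> b \<in> augmentation_power (Suc k)"
  unfolding augmentation_power_Suc by (rule ideal_prod.prod)

lemma augmentation_power_add:
  "\<lbrakk>a \<in> augmentation_power k; b \<in> augmentation_power k\<rbrakk> \<Longrightarrow> a + b \<in> augmentation_power k"
  using additive_subgroup.a_closed[OF ideal.axioms(1)[OF ideal_augmentation_power]] by simp

lemma augmentation_power_zero: "0 \<in> augmentation_power k"
  using additive_subgroup.zero_closed[OF ideal.axioms(1)[OF ideal_augmentation_power]] by simp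

lemma augmentation_power_uminus: "a \<in> augmentation_power k \<Longrightarrow> - a \<in> augmentation_power k"
  using additive_subgroup.a_inv_closed[OF ideal.axioms(1)[OF ideal_augmentation_power]] augmentation_power_carrier
  by (metis minus_group_ring)

lemma augmentation_power_diff:
  "\<lbrakk>a \<in> augmentation_power k; b \<in> augmentation_power k\<rbrakk> \<Longrightarrow> a - b \<in> augmentation_power k"
  using augmentation_power_add[of a k "- b"] augmentation_power_uminus[of b k] by simp

lemma augmentation_power_mult_carrier:
  assumes "a \<in> augmentation_power k" "x \<in> carrier G"
  shows "a \<otimes>\<^bsub>group_ring G\<^esub> frag_of x \<in> augmentation_power k"
  using ideal.I_r_closed[OF ideal_augmentation_power assms(1)] assms(2) by simp

text \<open>Powers grow by a factor on the right. For a factor on the left, a generating product i j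
  is rebracketed as a (i j) = (a i) j, and the induction hypothesis applies to a i.\<close>

lemma augmentation_power_mult_left:
  "\<lbrakk>a \<in> augmentation_ideal G; b \<in> augmentation_power k\<rbrakk>
    \<Longrightarrow> a \<otimes>\<^bsub>group_ring G\<^esub> b \<in> augmentation_power (Suc k)"
proof (induction k arbitrary: b)
  case 0
  then show ?case
    unfolding augmentation_power_1
    by (intro ideal.I_r_closed[OF ideal_augmentation_ideal])
      (use augmentation_power_carrier[of b 0] in simp_all)
next
  case (Suc k)
  from Suc.prems(2) show ?case
    unfolding augmentation_power_Suc[of k]
  proof (induction b rule: ideal_prod.induct)
    case (prod i j)
    have "(a \<otimes>\<^bsub>group_ring G\<^esub> i) \<otimes>\<^bsub>group_ring G\<^esub> j \<in> augmentation_power (Suc (Suc k))"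
      by (intro augmentation_power_mult_right Suc.IH Suc.prems(1) prod)
    then show ?case
      using Suc.prems(1) prod augmentation_power_carrier
      by (simp add: group_ring_mult_assoc augmentation_ideal_iff augmentation_power_Suc)
  next
    case (sum s1 s2)
    then show ?case
      using augmentation_power_add[of _ "Suc (Suc k)"]
      by (simp add: group_ring_mult_add_right augmentation_power_Suc)
  qed
qed

lemma frag_of_diff_one_in_augmentation_ideal:
  "x \<in> carrier G \<Longrightarrow> frag_of x - frag_of \<one> \<in> augmentation_ideal G"
  by (simp add: augmentation_ideal_iff order_trans[OF keys_diff])

end

section \<open>Lower central series and induced maps\<close>

context group
begin

text \<open>Meant for simplification of right-nested products, where an element meets its inverse in
  front of a further factor.\<close>

lemma inv_mult_cancel:
  assumes "x \<in> carrier G" "y \<in> carrier G"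
  shows "inv x \<otimes> (x \<otimes> y) = y" "x \<otimes> (inv x \<otimes> y) = y"
  using assms by (simp_all add: m_assoc[symmetric])

text \<open>The commutator is the solution c of c (y x) = x y. In this form it can be determined
  without a formula for inverses, as in \<open>derivation_group\<close>, and its triviality yields
  commutativity.\<close>

lemma commutator_mult:
  assumes "x \<in> carrier G" "y \<in> carrier G"
  shows "x \<otimes> y \<otimes> inv x \<otimes> inv y \<otimes> (y \<otimes> x) = x \<otimes> y"
  using assms by (simp add: m_assoc inv_mult_cancel)

lemma conj_commutator:
  assumes "g \<in> carrier G" "x \<in> carrier G" "y \<in> carrier G"
  shows "g \<otimes> (x \<otimes> y \<otimes> inv x \<otimes> inv y) \<otimes> inv g
    = (g \<otimes> x \<otimes> inv g) \<otimes> (g \<otimes> y \<otimes> inv g) \<otimes> inv (g \<otimes> x \<otimes> inv g) \<otimes> inv (g \<otimes> y \<otimes> inv g)"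
  using assms by (simp add: m_assoc inv_mult_group inv_mult_cancel)

text \<open>Conjugation is an automorphism preserving \<open>M\<close> and \<open>N\<close>, so it
  maps generating commutators to generating commutators.\<close>

lemma normal_commutator_subgroup:
  assumes "M \<lhd> G" "N \<lhd> G"
  shows "commutator_subgroup G M N \<lhd> G"
proof -
  interpret M: normal M G by fact
  interpret N: normal N G by fact
  show ?thesis
    unfolding commutator_subgroup_def
  proof (rule normal_generateI)
    fix z g
    assume "z \<in> (\<Union>h\<in>M. \<Union>k\<in>N. {h \<otimes> k \<otimes> inv h \<otimes> inv k})" and g: "g \<in> carrier G"
    then obtain x y where xy: "x \<in> M" "y \<in> N" "z = x \<otimes> y \<otimes> inv x \<otimes> inv y" by blast
    have "g \<otimes> z \<otimes> inv g = (g \<otimes> x \<otimes> inv g) \<otimes> (g \<otimes> y \<otimes> inv g)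
        \<otimes> inv (g \<otimes> x \<otimes> inv g) \<otimes> inv (g \<otimes> y \<otimes> inv g)"
      unfolding xy(3) by (rule conj_commutator[OF g M.mem_carrier[OF xy(1)] N.mem_carrier[OF xy(2)]])
    then show "g \<otimes> z \<otimes> inv g \<in> (\<Union>h\<in>M. \<Union>k\<in>N. {h \<otimes> k \<otimes> inv h \<otimes> inv k})"
      using M.inv_op_closed2[OF g xy(1)] N.inv_op_closed2[OF g xy(2)] by blast
  qed auto
qed

lemma normal_lower_central: "lower_central G k \<lhd> G"
proof (induction k)
  case 0
  show ?case by (simp add: normal_self)
next
  case (Suc k)
  then show ?case by (cases k) (simp_all add: normal_self normal_commutator_subgroup)
qed

lemma commutator_in_lower_central:
  assumes "k \<ge> 1" "x \<in> lower_central G k" "y \<in> carrier G"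
  shows "x \<otimes> y \<otimes> inv x \<otimes> inv y \<in> lower_central G (Suc k)"
  using assms by (cases k) (auto simp: commutator_subgroup_def intro!: generate.incl)

text \<open>Minimality of the lower central series, by induction on k. It is applied to preimages
  under a homomorphism and to the filtration of \<open>derivation_group\<close> by powers of the
  augmentation ideal.\<close>

lemma lower_central_subset_central_filtration:
  assumes sub: "\<And>k. k \<ge> 1 \<Longrightarrow> subgroup (N k) G"
    and first: "N 1 = carrier G"
    and comm: "\<And>k x y. \<lbrakk>k \<ge> 1; x \<in> N k; y \<in> carrier G\<rbrakk> \<Longrightarrow> x \<otimes> y \<otimes> inv x \<otimes> inv y \<in> N (Suc k)"
    and "k \<ge> 1"
  shows "lower_central G k \<subseteq> N k"
  using \<open>k \<ge> 1\<close>
proof (induction k rule: nat_induct_at_least)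
  case base
  then show ?case using first by simp
next
  case (Suc k)
  then obtain j where j: "k = Suc j" by (cases k) auto
  have "commutator_subgroup G (lower_central G k) (carrier G) \<subseteq> N (Suc k)"
    unfolding commutator_subgroup_def
  proof (rule generate_subgroup_incl)
    show "subgroup (N (Suc k)) G" by (rule sub) simp
    show "(\<Union>h\<in>lower_central G k. \<Union>y\<in>carrier G. {h \<otimes> y \<otimes> inv h \<otimes> inv y}) \<subseteq> N (Suc k)"
      using comm[OF Suc.hyps] Suc.IH by blast
  qed
  then show ?case by (simp add: j)
qed

lemma derived_subset_one:
  assumes "U \<subseteq> carrier G" "\<And>x y. \<lbrakk>x \<in> U; y \<in> U\<rbrakk> \<Longrightarrow> x \<otimes> y = y \<otimes> x"
  shows "derived G U \<subseteq> {\<one>}"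
  unfolding derived_def
proof (rule generate_subgroup_incl)
  have "x \<otimes> y \<otimes> inv x \<otimes> inv y = \<one>" if "x \<in> U" "y \<in> U" for x y
  proof -
    have "x \<in> carrier G" "y \<in> carrier G" using that assms(1) by auto
    moreover have "x \<otimes> y = y \<otimes> x" by (rule assms(2)[OF that])
    ultimately show ?thesis by (simp add: m_assoc)
  qed
  then show "derived_set G U \<subseteq> {\<one>}" by blast
qed (rule triv_subgroup)

lemma normal_Q_subgroup: "S \<lhd> G \<Longrightarrow> Q_subgroup n G S \<lhd> G"
  unfolding Q_subgroup_def
  by (rule normal_subgroup_set_mult_closed[OF derived_is_normal normal_lower_central])

end

text \<open>The preimages of the terms of the series of \<open>H\<close> form a central filtration
  of \<open>G\<close>.\<close>

lemma (in group_hom) hom_lower_central: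
  assumes "k \<ge> 1"
  shows "h ` lower_central G k \<subseteq> lower_central H k"
proof -
  have "lower_central G k \<subseteq> {x \<in> carrier G. h x \<in> lower_central H k}"
  proof (rule G.lower_central_subset_central_filtration)
    fix k :: nat
    interpret N: normal "lower_central H k" H by (rule H.normal_lower_central)
    show "subgroup {x \<in> carrier G. h x \<in> lower_central H k} G"
      by (rule G.subgroupI) auto
  next
    fix k x y
    assume "1 \<le> k" "x \<in> {x \<in> carrier G. h x \<in> lower_central H k}" "y \<in> carrier G"
    then show "x \<otimes>\<^bsub>G\<^esub> y \<otimes>\<^bsub>G\<^esub> inv\<^bsub>G\<^esub> x \<otimes>\<^bsub>G\<^esub> inv\<^bsub>G\<^esub> y \<in> {x \<in> carrier G. h x \<in> lower_central H (Suc k)}"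
      using H.commutator_in_lower_central[of k "h x" "h y"] by simp
  qed (use assms in auto)
  then show ?thesis by blast
qed

lemma (in group_hom) hom_Q_subgroup:
  assumes "n \<ge> 1" "R \<subseteq> carrier G" "h ` R \<subseteq> S"
  shows "h ` Q_subgroup n G R \<subseteq> Q_subgroup n H S"
proof
  fix y assume "y \<in> h ` Q_subgroup n G R"
  then obtain a b where ab: "a \<in> derived G R" "b \<in> lower_central G n" "y = h (a \<otimes>\<^bsub>G\<^esub> b)"
    unfolding Q_subgroup_def set_mult_def by blast
  have "a \<in> carrier G" using ab(1) G.derived_in_carrier[OF assms(2)] by blast
  moreover have "b \<in> carrier G"
    using ab(2) normal_imp_subgroup[OF G.normal_lower_central] subgroup.mem_carrier by metis
  moreover have "h a \<in> derived H S"
    using ab(1) derived_img[OF assms(2)] H.mono_derived[OF assms(3)] by blast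
  moreover have "h b \<in> lower_central H n" using ab(2) hom_lower_central[OF assms(1)] by blast
  ultimately show "y \<in> Q_subgroup n H S"
    unfolding Q_subgroup_def set_mult_def using ab(3) by auto
qed

text \<open>The image of the coset of x lies in N h(x), because h maps \<open>M\<close> into
  \<open>N\<close>, and it contains h(x); multiplying by \<open>N\<close> therefore gives exactly
  one coset.\<close>

lemma (in group_hom) quotient_map_r_coset:
  assumes "N \<lhd> H" "M \<lhd> G" "h ` M \<subseteq> N" "x \<in> carrier G"
  shows "quotient_map H N h (M #>\<^bsub>G\<^esub> x) = N #>\<^bsub>H\<^esub> h x"
proof -
  interpret N: normal N H by fact
  interpret M: normal M G by fact
  have hM: "h m \<in> N" if "m \<in> M" for m using that assms(3) by blast
  show ?thesis
  proof
    show "quotient_map H N h (M #>\<^bsub>G\<^esub> x) \<subseteq> N #>\<^bsub>H\<^esub> h x"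
      using assms(4) hM
      by (auto simp: quotient_map_def set_mult_def r_coset_def H.m_assoc[symmetric]
          intro!: exI bexI[of _ "_ \<otimes>\<^bsub>H\<^esub> _"])
    show "N #>\<^bsub>H\<^esub> h x \<subseteq> quotient_map H N h (M #>\<^bsub>G\<^esub> x)"
      using G.rcos_self[OF assms(4) M.subgroup_axioms]
      unfolding quotient_map_def set_mult_def r_coset_def[of H] by blast
  qed
qed

section \<open>From the equalizer to the dimension subgroup\<close>

text \<open>The semidirect product of \<open>G\<close> with its augmentation ideal: a homomorphism into it is a
  homomorphism to \<open>G\<close> together with a derivation \<open>d (x y) = d x \<cdot> y + d y\<close>.\<close>

definition derivation_group :: "('a, 'm) monoid_scheme \<Rightarrow> ('a \<times> ('a \<Rightarrow>\<^sub>0 int)) monoid" where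
  "derivation_group G =
    \<lparr>carrier = carrier G \<times> augmentation_ideal G,
     monoid.mult = (\<lambda>(g, a) (h, b). (g \<otimes>\<^bsub>G\<^esub> h, a \<otimes>\<^bsub>group_ring G\<^esub> frag_of h + b)),
     monoid.one = (\<one>\<^bsub>G\<^esub>, 0)\<rparr>"

lemma carrier_derivation_group [simp]:
    "carrier (derivation_group G) = carrier G \<times> augmentation_ideal G"
  and mult_derivation_group [simp]:
    "(g, a) \<otimes>\<^bsub>derivation_group G\<^esub> (h, b) = (g \<otimes>\<^bsub>G\<^esub> h, a \<otimes>\<^bsub>group_ring G\<^esub> frag_of h + b)"
  and one_derivation_group [simp]: "\<one>\<^bsub>derivation_group G\<^esub> = (\<one>\<^bsub>G\<^esub>, 0)"
  by (simp_all add: derivation_group_def)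

context group
begin

lemma group_derivation_group: "group (derivation_group G)"
proof (rule groupI)
  fix x y assume "x \<in> carrier (derivation_group G)" "y \<in> carrier (derivation_group G)"
  then show "x \<otimes>\<^bsub>derivation_group G\<^esub> y \<in> carrier (derivation_group G)"
    by (auto simp: augmentation_ideal_iff group_ring_mult_closed order_trans[OF keys_add])
next
  show "\<one>\<^bsub>derivation_group G\<^esub> \<in> carrier (derivation_group G)"
    by (simp add: augmentation_ideal_iff)
next
  fix x y z
  assume "x \<in> carrier (derivation_group G)" "y \<in> carrier (derivation_group G)"
    "z \<in> carrier (derivation_group G)"
  then show "x \<otimes>\<^bsub>derivation_group G\<^esub> y \<otimes>\<^bsub>derivation_group G\<^esub> z
      = x \<otimes>\<^bsub>derivation_group G\<^esub> (y \<otimes>\<^bsub>derivation_group G\<^esub> z)"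
    by (auto simp: augmentation_ideal_iff group_ring_mult_assoc m_assoc group_ring_mult_add_left
        simp flip: group_ring_mult_of_of)
next
  fix x assume "x \<in> carrier (derivation_group G)"
  then show "\<one>\<^bsub>derivation_group G\<^esub> \<otimes>\<^bsub>derivation_group G\<^esub> x = x" by auto
next
  fix x assume x: "x \<in> carrier (derivation_group G)"
  obtain g a where ga: "x = (g, a)" by (cases x)
  \<comment> \<open>The second component solves b g + a = 0. Writing \<open>0 - a\<close> for the
    negative makes the rule for products of differences applicable.\<close>
  let ?y = "(inv g, (0 - a) \<otimes>\<^bsub>group_ring G\<^esub> frag_of (inv g))"
  have "?y \<otimes>\<^bsub>derivation_group G\<^esub> x = \<one>\<^bsub>derivation_group G\<^esub>"
    using x by (simp add: ga group_ring_mult_assoc augmentation_ideal_iff group_ring_mult_one)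
  moreover have "?y \<in> carrier (derivation_group G)"
    using x augmentation_diff[of 0 a] by (simp add: ga augmentation_ideal_iff group_ring_mult_closed)
  ultimately show "\<exists>y\<in>carrier (derivation_group G).
      y \<otimes>\<^bsub>derivation_group G\<^esub> x = \<one>\<^bsub>derivation_group G\<^esub>" by blast
qed

text \<open>This is the derivation rule for x - 1; it makes x \<mapsto> (x, x - 1) a homomorphism
  into \<open>derivation_group\<close>.\<close>

lemma frag_of_mult_diff_one:
  assumes "x \<in> carrier G" "y \<in> carrier G"
  shows "frag_of (x \<otimes> y) - frag_of \<one>
    = (frag_of x - frag_of \<one>) \<otimes>\<^bsub>group_ring G\<^esub> frag_of y + (frag_of y - frag_of \<one>)"
  using assms by (simp add: group_ring_mult_diff_left)

text \<open>Group elements are units of the group ring: multiplying by \<open>inv x\<close> on the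
  right recovers \<open>a\<close>.\<close>

lemma augmentation_power_cancel:
  assumes "a \<otimes>\<^bsub>group_ring G\<^esub> frag_of x \<in> augmentation_power k" "x \<in> carrier G"
    "Poly_Mapping.keys a \<subseteq> carrier G"
  shows "a \<in> augmentation_power k"
  using augmentation_power_mult_carrier[OF assms(1), of "inv x"] assms(2,3)
  by (simp add: group_ring_mult_assoc group_ring_mult_one)

text \<open>The condition on g has to be carried along: up to a unit on the right, the commutator of
  (g, a) and (h, b) has second component a (h - 1) - b (g - 1), and the last term reaches the next
  power through g - 1.\<close>

lemma lower_central_derivation_group:
  assumes "k \<ge> 1"
  shows "lower_central (derivation_group G) k
    \<subseteq> {(g, a). g \<in> carrier G \<and> frag_of g - frag_of \<one> \<in> augmentation_power k \<and> a \<in> augmentation_power k}"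
    (is "_ \<subseteq> ?N k")
proof (rule group.lower_central_subset_central_filtration[OF group_derivation_group])
  interpret D: group "derivation_group G" by (rule group_derivation_group)
  fix k :: nat assume "k \<ge> 1"
  \<comment> \<open>For exponents from 1 on the power lies in the augmentation ideal, where second
    components live; the power with exponent 0 is the whole ring.\<close>
  then have sub: "?N k \<subseteq> carrier (derivation_group G)"
    using augmentation_power_Suc_subset[of "k - 1"] by auto
  show "subgroup (?N k) (derivation_group G)"
  proof (rule D.subgroupI[OF sub])
    show "?N k \<noteq> {}" using augmentation_power_zero[of k] by (auto intro!: exI[of _ \<one>])
  next
    fix x assume x: "x \<in> ?N k"
    obtain g a where ga: "x = (g, a)" by (cases x)
    \<comment> \<open>No formula for the inverse is used: as a left inverse of (g, a), the pair (h,
      b) satisfies h g = 1 and b g = - a, and g can be cancelled.\<close>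
    obtain h b where hb: "inv\<^bsub>derivation_group G\<^esub> x = (h, b)" by (cases "inv\<^bsub>derivation_group G\<^esub> x")
    have h: "h \<in> carrier G" "b \<in> augmentation_ideal G"
      using D.inv_closed[of x] x sub by (auto simp: hb)
    have "(h, b) \<otimes>\<^bsub>derivation_group G\<^esub> (g, a) = \<one>\<^bsub>derivation_group G\<^esub>"
      using D.l_inv[of x] x sub unfolding hb unfolding ga by blast
    then have eq: "h \<otimes> g = \<one>" "b \<otimes>\<^bsub>group_ring G\<^esub> frag_of g + a = 0" by simp_all
    have g: "g \<in> carrier G" "frag_of g - frag_of \<one> \<in> augmentation_power k" "a \<in> augmentation_power k"
      using x by (simp_all add: ga)
    have "b \<otimes>\<^bsub>group_ring G\<^esub> frag_of g = - a" using eq(2) by (rule add_eq_0_iff2[THEN iffD1])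
    then have "b \<otimes>\<^bsub>group_ring G\<^esub> frag_of g \<in> augmentation_power k"
      using augmentation_power_uminus[OF g(3)] by simp
    then have "b \<in> augmentation_power k"
      by (rule augmentation_power_cancel) (use g h in \<open>simp_all add: augmentation_ideal_iff\<close>)
    moreover have "(frag_of h - frag_of \<one>) \<otimes>\<^bsub>group_ring G\<^esub> frag_of g = - (frag_of g - frag_of \<one>)"
      using g h eq(1) by (simp add: group_ring_mult_diff_left)
    then have "(frag_of h - frag_of \<one>) \<otimes>\<^bsub>group_ring G\<^esub> frag_of g \<in> augmentation_power k"
      using augmentation_power_uminus[OF g(2)] by simp
    then have "frag_of h - frag_of \<one> \<in> augmentation_power k"
      by (rule augmentation_power_cancel)
        (use g frag_of_diff_one_in_augmentation_ideal[OF h(1)] in \<open>simp_all add: augmentation_ideal_iff\<close>)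
    ultimately show "inv\<^bsub>derivation_group G\<^esub> x \<in> ?N k" using h by (simp add: hb)
  next
    fix x y assume "x \<in> ?N k" "y \<in> ?N k"
    then show "x \<otimes>\<^bsub>derivation_group G\<^esub> y \<in> ?N k"
      by (auto simp: frag_of_mult_diff_one
          intro!: augmentation_power_add augmentation_power_mult_carrier)
  qed
next
  show "?N 1 = carrier (derivation_group G)"
    using frag_of_diff_one_in_augmentation_ideal
    unfolding One_nat_def augmentation_power_1 by auto
next
  interpret D: group "derivation_group G" by (rule group_derivation_group)
  fix k :: nat and x y
  assume k: "k \<ge> 1" and x: "x \<in> ?N k" and y: "y \<in> carrier (derivation_group G)"
  let ?c = "x \<otimes>\<^bsub>derivation_group G\<^esub> y \<otimes>\<^bsub>derivation_group G\<^esub> inv\<^bsub>derivation_group G\<^esub> x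
    \<otimes>\<^bsub>derivation_group G\<^esub> inv\<^bsub>derivation_group G\<^esub> y"
  obtain g a where ga: "x = (g, a)" by (cases x)
  obtain h b where hb: "y = (h, b)" by (cases y)
  obtain z e where ze: "?c = (z, e)" by (cases ?c)
  have g: "g \<in> carrier G" "frag_of g - frag_of \<one> \<in> augmentation_power k" "a \<in> augmentation_power k"
    using x by (simp_all add: ga)
  have h: "h \<in> carrier G" "b \<in> augmentation_ideal G" using y by (simp_all add: hb)
  have x': "x \<in> carrier (derivation_group G)"
    using g k augmentation_power_Suc_subset[of "k - 1"] by (auto simp: ga)
  have z: "z \<in> carrier G" "e \<in> augmentation_ideal G"
    using D.m_closed[OF D.m_closed[OF D.m_closed[OF x' y] D.inv_closed[OF x']] D.inv_closed[OF y]]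
    by (simp_all add: ze)
  \<comment> \<open>Comparing components in c (y x) = x y with c = (z, e) gives z h g = g h and e h
    g + b g + a = a h + b.\<close>
  have "?c \<otimes>\<^bsub>derivation_group G\<^esub> (y \<otimes>\<^bsub>derivation_group G\<^esub> x) = x \<otimes>\<^bsub>derivation_group G\<^esub> y"
    by (rule D.commutator_mult[OF x' y])
  then have eq: "z \<otimes> (h \<otimes> g) = g \<otimes> h"
    "e \<otimes>\<^bsub>group_ring G\<^esub> frag_of (h \<otimes> g) + (b \<otimes>\<^bsub>group_ring G\<^esub> frag_of g + a) = a \<otimes>\<^bsub>group_ring G\<^esub> frag_of h + b"
    unfolding ze unfolding ga hb mult_derivation_group prod.inject by blast+
  have keys: "Poly_Mapping.keys a \<subseteq> carrier G" "Poly_Mapping.keys b \<subseteq> carrier G"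
    "Poly_Mapping.keys e \<subseteq> carrier G" "Poly_Mapping.keys (frag_of z - frag_of \<one>) \<subseteq> carrier G"
    using augmentation_power_carrier[OF g(3)] h(2) z frag_of_diff_one_in_augmentation_ideal[OF z(1)]
    by (simp_all add: augmentation_ideal_iff)
  have "e \<otimes>\<^bsub>group_ring G\<^esub> frag_of (h \<otimes> g)
      = (a \<otimes>\<^bsub>group_ring G\<^esub> frag_of h + b) - (b \<otimes>\<^bsub>group_ring G\<^esub> frag_of g + a)"
    using eq(2) by (rule eq_diff_eq[THEN iffD2])
  also have "\<dots> = a \<otimes>\<^bsub>group_ring G\<^esub> (frag_of h - frag_of \<one>) - b \<otimes>\<^bsub>group_ring G\<^esub> (frag_of g - frag_of \<one>)"
    using keys by (simp add: group_ring_mult_diff_right group_ring_mult_one)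
  also have "\<dots> \<in> augmentation_power (Suc k)"
    by (intro augmentation_power_diff[OF augmentation_power_mult_right augmentation_power_mult_left]
        frag_of_diff_one_in_augmentation_ideal g h)
  finally have "e \<in> augmentation_power (Suc k)"
    by (rule augmentation_power_cancel) (simp_all add: g h keys)
  \<comment> \<open>Since z h g = g h, the left side is g h - h g, which is the ring commutator of g
    - 1 and h - 1.\<close>
  moreover have "(frag_of z - frag_of \<one>) \<otimes>\<^bsub>group_ring G\<^esub> frag_of (h \<otimes> g)
      = (frag_of g - frag_of \<one>) \<otimes>\<^bsub>group_ring G\<^esub> (frag_of h - frag_of \<one>)
        - (frag_of h - frag_of \<one>) \<otimes>\<^bsub>group_ring G\<^esub> (frag_of g - frag_of \<one>)"
    using g(1) h(1) z(1) eq(1) by (simp add: group_ring_mult_diff_left group_ring_mult_diff_right)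
  then have "(frag_of z - frag_of \<one>) \<otimes>\<^bsub>group_ring G\<^esub> frag_of (h \<otimes> g) \<in> augmentation_power (Suc k)"
    by (simp only:) (intro augmentation_power_diff[OF augmentation_power_mult_right augmentation_power_mult_left]
        frag_of_diff_one_in_augmentation_ideal g h)
  then have "frag_of z - frag_of \<one> \<in> augmentation_power (Suc k)"
    by (rule augmentation_power_cancel) (simp_all add: g h keys)
  ultimately show "?c \<in> ?N (Suc k)" using z(1) unfolding ze by blast
qed (rule assms)

end

text \<open>Modulo the derived subgroup of the kernel of \<open>p\<close>, which \<phi> kills, x
  inv(y) is an element c of \<open>lower_central H n\<close>. Its image has second component in
  power n, and \<phi> x = \<phi> c \<phi> y turns this into a statement about g - 1.\<close>

lemma (in group) hom_lift_imp_dimension_subgroup: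
  assumes H: "group H"
    and p: "p \<in> hom H G" and phi: "\<phi> \<in> hom H (derivation_group G)"
    and fst: "\<And>h. h \<in> carrier H \<Longrightarrow> fst (\<phi> h) = p h"
    and x: "x \<in> carrier H" "\<phi> x = (g, frag_of g - frag_of \<one>)"
    and y: "y \<in> carrier H" "\<phi> y = (g, 0)"
    and n: "n \<ge> 1"
    and xy: "x \<otimes>\<^bsub>H\<^esub> inv\<^bsub>H\<^esub> y \<in> Q_subgroup n H (kernel H G p)"
  shows "g \<in> dimension_subgroup G n"
proof -
  let ?D = "derivation_group G"
  interpret H: group H by fact
  interpret D: group ?D by (rule group_derivation_group)
  interpret phi: group_hom H ?D \<phi> by unfold_locales (rule phi)
  interpret p: group_hom H G p by unfold_locales (rule p)
  let ?S = "kernel H G p"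
  have S: "?S \<subseteq> carrier H" by (auto simp: kernel_def)
  obtain s c where s: "s \<in> derived H ?S" and c: "c \<in> lower_central H n"
    and eq: "x \<otimes>\<^bsub>H\<^esub> inv\<^bsub>H\<^esub> y = s \<otimes>\<^bsub>H\<^esub> c"
    using xy unfolding Q_subgroup_def set_mult_def by blast
  have carr: "s \<in> carrier H" "c \<in> carrier H"
    using s H.derived_in_carrier[OF S] c subgroup.mem_carrier[OF normal_imp_subgroup[OF H.normal_lower_central]]
    by blast+
  \<comment> \<open>Elements of the kernel go to pairs with first component 1; such pairs multiply
    by adding second components, hence commute.\<close>
  have "derived ?D (\<phi> ` ?S) \<subseteq> {\<one>\<^bsub>?D\<^esub>}"
  proof (rule D.derived_subset_one)
    fix u v assume uv: "u \<in> \<phi> ` ?S" "v \<in> \<phi> ` ?S"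
    have *: "\<exists>a \<in> augmentation_ideal G. w = (\<one>, a)" if "w \<in> \<phi> ` ?S" for w
    proof -
      from that obtain k where k: "k \<in> carrier H" "p k = \<one>" "w = \<phi> k" by (auto simp: kernel_def)
      then show ?thesis using fst[OF k(1)] phi.hom_closed[OF k(1)] by (cases w) auto
    qed
    obtain a b where "a \<in> augmentation_ideal G" "b \<in> augmentation_ideal G" "u = (\<one>, a)" "v = (\<one>, b)"
      using *[OF uv(1)] *[OF uv(2)] by blast
    then show "u \<otimes>\<^bsub>?D\<^esub> v = v \<otimes>\<^bsub>?D\<^esub> u"
      by (simp add: group_ring_mult_one augmentation_ideal_iff add.commute)
  qed (use S in \<open>auto simp del: carrier_derivation_group\<close>)
  then have "\<phi> s = \<one>\<^bsub>?D\<^esub>" using s phi.derived_img[OF S] by blast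
  then have c': "\<phi> (x \<otimes>\<^bsub>H\<^esub> inv\<^bsub>H\<^esub> y) = \<phi> c"
    unfolding eq using carr by (simp del: carrier_derivation_group one_derivation_group)
  have "x = (x \<otimes>\<^bsub>H\<^esub> inv\<^bsub>H\<^esub> y) \<otimes>\<^bsub>H\<^esub> y" using x y by (simp add: H.m_assoc)
  then have "\<phi> x = \<phi> (x \<otimes>\<^bsub>H\<^esub> inv\<^bsub>H\<^esub> y) \<otimes>\<^bsub>?D\<^esub> \<phi> y"
    using x y phi.hom_mult by (metis H.inv_closed H.m_closed)
  then have e: "\<phi> x = \<phi> c \<otimes>\<^bsub>?D\<^esub> \<phi> y" unfolding c' .
  obtain z a where za: "\<phi> c = (z, a)" by (cases "\<phi> c")
  have "\<phi> c \<in> lower_central ?D n" using c phi.hom_lower_central[OF n] by blast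
  then have a: "a \<in> augmentation_power n"
    using lower_central_derivation_group[OF n] unfolding za by blast
  have g: "g \<in> carrier G" using phi.hom_closed[OF y(1)] y(2) by simp
  \<comment> \<open>Second components of (g, g - 1) = (z, a) (g, 0).\<close>
  have "frag_of g - frag_of \<one> = a \<otimes>\<^bsub>group_ring G\<^esub> frag_of g"
    using e unfolding za x(2) y(2) by simp
  then show ?thesis
    using augmentation_power_mult_carrier[OF a g] g by (simp add: dimension_subgroup_def)
qed

text \<open>The universal property of the free product supplies the homomorphism \<phi>: it sends x
  to (\<pi> x, \<pi> x - 1) on the first copy and to (\<pi> x, 0) on the second.\<close>

lemma (in group) free_product_equalizer_imp_dimension_subgroup:
  assumes F: "group F" and pi: "\<pi> \<in> hom F G" and n: "n \<ge> 1" and x: "x \<in> carrier F"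
    and "free_product_inl F F x \<otimes>\<^bsub>free_product F F\<^esub> inv\<^bsub>free_product F F\<^esub> (free_product_inr F F x)
      \<in> Q_subgroup n (free_product F F) (kernel (free_product F F) G (free_product_lift G \<pi> \<pi>))"
  shows "\<pi> x \<in> dimension_subgroup G n"
proof -
  let ?D = "derivation_group G" and ?H = "free_product F F"
  let ?l = "\<lambda>x. (\<pi> x, frag_of (\<pi> x) - frag_of \<one>)" and ?r = "\<lambda>x. (\<pi> x, 0)"
  let ?\<phi> = "free_product_lift ?D ?l ?r"
  interpret pi: group_hom F G \<pi>
    using F pi by (simp add: group_hom_def group_hom_axioms_def is_group)
  have D: "group ?D" by (rule group_derivation_group)
  have l: "?l \<in> hom F ?D"
    by (rule homI) (auto simp: frag_of_diff_one_in_augmentation_ideal frag_of_mult_diff_one)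
  have r: "?r \<in> hom F ?D"
    by (rule homI) (auto simp: augmentation_ideal_iff)
  have phi: "?\<phi> \<in> hom ?H ?D" by (rule free_product_lift_hom[OF F F D l r])
  have "fst \<in> hom ?D G" by (rule homI) auto
  then have "fst \<circ> ?\<phi> \<in> hom ?H G" by (rule Group.hom_compose[OF phi])
  \<comment> \<open>Both maps to \<open>G\<close> restrict to \<pi> on each copy of
    \<open>F\<close>, so uniqueness of the lift identifies them.\<close>
  then have fst: "fst (?\<phi> h) = free_product_lift G \<pi> \<pi> h" if "h \<in> carrier ?H" for h
    using free_product_lift_unique[OF F F is_group pi pi _ _ _ that, of "fst \<circ> ?\<phi>"]
      free_product_lift_inl[OF F F D l r] free_product_lift_inr[OF F F D l r] by simp
  show ?thesis
  proof (rule hom_lift_imp_dimension_subgroup[OF group_free_product[OF F F]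
        free_product_lift_hom[OF F F is_group pi pi] phi fst _ _ _ _ n])
    show "free_product_inl F F x \<in> carrier ?H" "free_product_inr F F x \<in> carrier ?H"
      using x by (auto intro: hom_in_carrier free_product_inl_hom free_product_inr_hom F)
    show "?\<phi> (free_product_inl F F x) = ?l (x)" "?\<phi> (free_product_inr F F x) = ?r x"
      by (rule free_product_lift_inl[OF F F D l r x], rule free_product_lift_inr[OF F F D l r x])
  qed (use assms in auto)
qed

section \<open>From the dimension subgroup to the equalizer\<close>

text \<open>A derivation \<open>d\<close> modulo the subgroups \<open>V k\<close>. The maps \<open>act h\<close> need not form an action, so that
  \<open>d\<close> and \<open>act\<close> can be built from a set-theoretic section of \<open>F \<rightarrow> G\<close>.\<close>

lemma (in group) derivation_dimension_subgroup:
  assumes K: "comm_group K"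
    and V: "\<And>k. k \<ge> 1 \<Longrightarrow> subgroup (V k) K" "V 1 = carrier K"
    and act: "\<And>h. h \<in> carrier G \<Longrightarrow> act h \<in> hom K K"
    and step: "\<And>k h v. \<lbrakk>k \<ge> 1; h \<in> carrier G; v \<in> V k\<rbrakk> \<Longrightarrow> inv\<^bsub>K\<^esub> v \<otimes>\<^bsub>K\<^esub> act h v \<in> V (Suc k)"
    and d: "\<And>g. g \<in> carrier G \<Longrightarrow> d g \<in> carrier K"
    and cocycle: "\<And>k g h. \<lbrakk>k \<ge> 1; g \<in> carrier G; h \<in> carrier G\<rbrakk>
      \<Longrightarrow> inv\<^bsub>K\<^esub> d (g \<otimes> h) \<otimes>\<^bsub>K\<^esub> (act h (d g) \<otimes>\<^bsub>K\<^esub> d h) \<in> V k"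
    and n: "n \<ge> 1" and g: "g \<in> dimension_subgroup G n"
  shows "d g \<otimes>\<^bsub>K\<^esub> inv\<^bsub>K\<^esub> d \<one> \<in> V n"
proof -
  interpret K: comm_group K by fact
  let ?Z = "free_Abelian_group (carrier G)"
  \<comment> \<open>\<Phi> is the additive extension of \<open>d\<close> to the group ring, written
    multiplicatively in \<open>K\<close>.\<close>
  obtain \<Phi> where Phi: "\<Phi> \<in> hom ?Z K" and Phi_of: "\<And>x. x \<in> carrier G \<Longrightarrow> \<Phi> (frag_of x) = d x"
    using K.free_Abelian_group_universal[of d "carrier G"] d by blast
  interpret Z: comm_group ?Z by (rule abelian_free_Abelian_group)
  interpret Phi: group_hom ?Z K \<Phi> by unfold_locales (rule Phi)
  have closed: "\<Phi> a \<in> carrier K" if "Poly_Mapping.keys a \<subseteq> carrier G" for a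
    using that Phi.hom_closed[of a] by simp
  have Phi_add: "\<Phi> (a + b) = \<Phi> a \<otimes>\<^bsub>K\<^esub> \<Phi> b"
    if "Poly_Mapping.keys a \<subseteq> carrier G" "Poly_Mapping.keys b \<subseteq> carrier G" for a b
    using that Phi.hom_mult[of a b] by simp
  have Phi_diff: "\<Phi> (a - b) = \<Phi> a \<otimes>\<^bsub>K\<^esub> inv\<^bsub>K\<^esub> \<Phi> b"
    if "Poly_Mapping.keys a \<subseteq> carrier G" "Poly_Mapping.keys b \<subseteq> carrier G" for a b
    using that Phi_add[of a "- b"] Phi.hom_inv[of b] by simp
  have Phi_0: "\<Phi> 0 = \<one>\<^bsub>K\<^esub>" using Phi.hom_one by simp
  have act_closed: "act h v \<in> carrier K" if "h \<in> carrier G" "v \<in> carrier K" for h v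
    using act[OF that(1)] that(2) by (rule hom_in_carrier)
  have diff_inv: "(a \<otimes>\<^bsub>K\<^esub> inv\<^bsub>K\<^esub> a') \<otimes>\<^bsub>K\<^esub> (b \<otimes>\<^bsub>K\<^esub> inv\<^bsub>K\<^esub> b') = (a \<otimes>\<^bsub>K\<^esub> b) \<otimes>\<^bsub>K\<^esub> inv\<^bsub>K\<^esub> (a' \<otimes>\<^bsub>K\<^esub> b')"
    if "a \<in> carrier K" "a' \<in> carrier K" "b \<in> carrier K" "b' \<in> carrier K" for a a' b b'
    using that by (simp add: K.inv_mult K.m_ac)
  \<comment> \<open>Additive extension of the cocycle condition: modulo V k, \<Phi>(a h) is act h
    (\<Phi> a) times d h to the power of the augmentation of a. The support condition is part of the
    claim because the difference case supplies only the claim for its two terms.\<close>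
  have right: "Poly_Mapping.keys a \<subseteq> carrier G \<and>
      inv\<^bsub>K\<^esub> \<Phi> (a \<otimes>\<^bsub>group_ring G\<^esub> frag_of h)
        \<otimes>\<^bsub>K\<^esub> (act h (\<Phi> a) \<otimes>\<^bsub>K\<^esub> d h [^]\<^bsub>K\<^esub> augmentation a) \<in> V k"
    if "k \<ge> 1" "h \<in> carrier G" "Poly_Mapping.keys a \<subseteq> carrier G" for k h a
    using that(3)
  proof (induction a rule: frag_induction)
    case zero
    have "act h \<one>\<^bsub>K\<^esub> = \<one>\<^bsub>K\<^esub>" by (rule hom_one[OF act[OF that(2)] K.is_group K.is_group])
    then show ?case using subgroup.one_closed[OF V(1)[OF that(1)]] by (simp add: Phi_0)
  next
    case (one x)
    then show ?case using cocycle[OF that(1) one that(2)] that d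
      by (simp add: Phi_of K.int_pow_1)
  next
    case (diff a b)
    interpret act: group_hom K K "act h" by unfold_locales (rule act[OF that(2)])
    let ?ah = "a \<otimes>\<^bsub>group_ring G\<^esub> frag_of h" and ?bh = "b \<otimes>\<^bsub>group_ring G\<^esub> frag_of h"
    have k: "Poly_Mapping.keys a \<subseteq> carrier G" "Poly_Mapping.keys b \<subseteq> carrier G"
      "Poly_Mapping.keys ?ah \<subseteq> carrier G" "Poly_Mapping.keys ?bh \<subseteq> carrier G"
      using diff that by (simp_all add: group_ring_mult_closed)
    have "inv\<^bsub>K\<^esub> \<Phi> ((a - b) \<otimes>\<^bsub>group_ring G\<^esub> frag_of h)
        \<otimes>\<^bsub>K\<^esub> (act h (\<Phi> (a - b)) \<otimes>\<^bsub>K\<^esub> d h [^]\<^bsub>K\<^esub> augmentation (a - b))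
      = (inv\<^bsub>K\<^esub> \<Phi> ?ah \<otimes>\<^bsub>K\<^esub> inv\<^bsub>K\<^esub> (inv\<^bsub>K\<^esub> \<Phi> ?bh))
        \<otimes>\<^bsub>K\<^esub> ((act h (\<Phi> a) \<otimes>\<^bsub>K\<^esub> inv\<^bsub>K\<^esub> act h (\<Phi> b))
          \<otimes>\<^bsub>K\<^esub> (d h [^]\<^bsub>K\<^esub> augmentation a \<otimes>\<^bsub>K\<^esub> inv\<^bsub>K\<^esub> (d h [^]\<^bsub>K\<^esub> augmentation b)))"
      using k closed d[OF that(2)]
      by (simp add: group_ring_mult_diff_left Phi_diff K.inv_mult K.int_pow_diff)
    also have "\<dots> = (inv\<^bsub>K\<^esub> \<Phi> ?ah \<otimes>\<^bsub>K\<^esub> (act h (\<Phi> a) \<otimes>\<^bsub>K\<^esub> d h [^]\<^bsub>K\<^esub> augmentation a))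
        \<otimes>\<^bsub>K\<^esub> inv\<^bsub>K\<^esub> (inv\<^bsub>K\<^esub> \<Phi> ?bh \<otimes>\<^bsub>K\<^esub> (act h (\<Phi> b) \<otimes>\<^bsub>K\<^esub> d h [^]\<^bsub>K\<^esub> augmentation b))"
      using k closed d[OF that(2)] by (simp only: diff_inv K.inv_closed K.m_closed K.int_pow_closed act.hom_closed)
    also have "\<dots> \<in> V k"
      using diff V(1)[OF that(1)] by (blast intro: subgroup.m_closed subgroup.m_inv_closed)
    finally show ?case using k keys_diff[of a b] by blast
  qed
  \<comment> \<open>Induction on the exponent. For i in power k, with k at least 1, the claim is
    that \<Phi>(i b) is \<Phi>(i) to the power of the augmentation of b, modulo V (k + 1).\<close>
  have main: "\<Phi> a \<in> V k" if "k \<ge> 1" "a \<in> augmentation_power k" for k a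
    using that
  proof (induction k arbitrary: a rule: nat_induct_at_least)
    case base
    then show ?case using closed augmentation_power_carrier V(2) by blast
  next
    case (Suc k)
    have VS: "subgroup (V (Suc k)) K" by (rule V(1)) simp
    from Suc.prems show ?case
      unfolding augmentation_power_Suc
    proof (induction a rule: ideal_prod.induct)
      case (prod i j)
      obtain k' where "k = Suc k'" using Suc.hyps by (cases k) auto
      then have "i \<in> augmentation_ideal G"
        using augmentation_power_Suc_subset[of k'] prod(1) by blast
      then have i: "Poly_Mapping.keys i \<subseteq> carrier G" "augmentation i = 0"
        by (simp_all add: augmentation_ideal_iff)
      have Pi: "\<Phi> i \<in> V k" "\<Phi> i \<in> carrier K" by (rule Suc.IH[OF prod(1)], rule closed[OF i(1)])
      have "Poly_Mapping.keys b \<subseteq> carrier G \<and>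
          \<Phi> (i \<otimes>\<^bsub>group_ring G\<^esub> b) \<otimes>\<^bsub>K\<^esub> inv\<^bsub>K\<^esub> (\<Phi> i [^]\<^bsub>K\<^esub> augmentation b) \<in> V (Suc k)"
        if "Poly_Mapping.keys b \<subseteq> carrier G" for b
        using that
      proof (induction b rule: frag_induction)
        case zero
        then show ?case using subgroup.one_closed[OF VS] by (simp add: Phi_0)
      next
        case (one h)
        \<comment> \<open>As i has augmentation 0, \<open>right\<close> compares \<Phi>(i h) with
          act h (\<Phi> i), and \<open>step\<close> compares the latter with \<Phi> i; in the
          quotient of both elements the action cancels.\<close>
        let ?u = "inv\<^bsub>K\<^esub> \<Phi> (i \<otimes>\<^bsub>group_ring G\<^esub> frag_of h) \<otimes>\<^bsub>K\<^esub> act h (\<Phi> i)"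
        have c: "act h (\<Phi> i) \<in> carrier K" "\<Phi> (i \<otimes>\<^bsub>group_ring G\<^esub> frag_of h) \<in> carrier K"
          using one i Pi by (simp_all add: act_closed closed group_ring_mult_closed)
        have "?u \<in> V (Suc k)" using right[of "Suc k" h i] one i c d[OF one] by simp
        moreover have "inv\<^bsub>K\<^esub> \<Phi> i \<otimes>\<^bsub>K\<^esub> act h (\<Phi> i) \<in> V (Suc k)"
          by (rule step[OF Suc.hyps one Pi(1)])
        ultimately have "(inv\<^bsub>K\<^esub> \<Phi> i \<otimes>\<^bsub>K\<^esub> act h (\<Phi> i)) \<otimes>\<^bsub>K\<^esub> inv\<^bsub>K\<^esub> ?u \<in> V (Suc k)"
          using VS by (blast intro: subgroup.m_closed subgroup.m_inv_closed)
        moreover have "(inv\<^bsub>K\<^esub> \<Phi> i \<otimes>\<^bsub>K\<^esub> act h (\<Phi> i)) \<otimes>\<^bsub>K\<^esub> inv\<^bsub>K\<^esub> ?u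
            = \<Phi> (i \<otimes>\<^bsub>group_ring G\<^esub> frag_of h) \<otimes>\<^bsub>K\<^esub> inv\<^bsub>K\<^esub> \<Phi> i"
          using c Pi by (simp add: K.inv_mult K.m_ac K.inv_mult_cancel)
        ultimately show ?case using one Pi by (simp add: K.int_pow_1)
      next
        case (diff a b)
        let ?ia = "i \<otimes>\<^bsub>group_ring G\<^esub> a" and ?ib = "i \<otimes>\<^bsub>group_ring G\<^esub> b"
        have ks: "Poly_Mapping.keys a \<subseteq> carrier G" "Poly_Mapping.keys b \<subseteq> carrier G"
          "Poly_Mapping.keys ?ia \<subseteq> carrier G" "Poly_Mapping.keys ?ib \<subseteq> carrier G"
          using diff i by (simp_all add: group_ring_mult_closed)
        have "\<Phi> (i \<otimes>\<^bsub>group_ring G\<^esub> (a - b)) \<otimes>\<^bsub>K\<^esub> inv\<^bsub>K\<^esub> (\<Phi> i [^]\<^bsub>K\<^esub> augmentation (a - b))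
          = (\<Phi> ?ia \<otimes>\<^bsub>K\<^esub> inv\<^bsub>K\<^esub> \<Phi> ?ib) \<otimes>\<^bsub>K\<^esub> (inv\<^bsub>K\<^esub> (\<Phi> i [^]\<^bsub>K\<^esub> augmentation a)
              \<otimes>\<^bsub>K\<^esub> inv\<^bsub>K\<^esub> (inv\<^bsub>K\<^esub> (\<Phi> i [^]\<^bsub>K\<^esub> augmentation b)))"
          using ks closed Pi
          by (simp add: group_ring_mult_diff_right Phi_diff K.inv_mult K.int_pow_diff)
        also have "\<dots> = (\<Phi> ?ia \<otimes>\<^bsub>K\<^esub> inv\<^bsub>K\<^esub> (\<Phi> i [^]\<^bsub>K\<^esub> augmentation a))
            \<otimes>\<^bsub>K\<^esub> inv\<^bsub>K\<^esub> (\<Phi> ?ib \<otimes>\<^bsub>K\<^esub> inv\<^bsub>K\<^esub> (\<Phi> i [^]\<^bsub>K\<^esub> augmentation b))"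
          using ks closed Pi by (simp only: diff_inv K.inv_closed K.int_pow_closed)
        also have "\<dots> \<in> V (Suc k)"
          using diff VS by (blast intro: subgroup.m_closed subgroup.m_inv_closed)
        finally show ?case using ks keys_diff[of a b] by blast
      qed
      \<comment> \<open>The factor j has augmentation 0, so the power of \<Phi> i is
        trivial.\<close>
      from this[of j] show ?case
        using prod(2) i Pi closed[OF group_ring_mult_closed[OF i(1), of j]]
        by (simp add: augmentation_ideal_iff)
    next
      case (sum s1 s2)
      have "Poly_Mapping.keys s1 \<subseteq> carrier G" "Poly_Mapping.keys s2 \<subseteq> carrier G"
        using sum(1,2) augmentation_power_carrier[of _ "Suc k"] unfolding augmentation_power_Suc by blast+
      then show ?case using subgroup.m_closed[OF VS sum(3,4)] by (simp add: Phi_add)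
    qed
  qed
  have gc: "g \<in> carrier G" "frag_of g - frag_of \<one> \<in> augmentation_power n"
    using g by (simp_all add: dimension_subgroup_def)
  \<comment> \<open>The value is \<Phi>(g - 1). The factor at the unit remains, because
    \<open>d\<close> is a derivation only modulo V.\<close>
  then show ?thesis using main[OF n gc(2)] by (simp add: Phi_diff Phi_of)
qed

text \<open>The quotient of i by j is a derivation into S/S'. Composed with a section of \<pi> it
  satisfies \<open>derivation_dimension_subgroup\<close>; the values on the kernel of \<pi>, which
  are part of V, are removed at the end by changing the preimage of g.\<close>

lemma dimension_subgroup_lift:
  assumes F: "group F" and G: "group G" and H: "group H"
    and pi: "\<pi> \<in> epi F G" and p: "p \<in> hom H G"
    and i: "i \<in> hom F H" "\<And>x. x \<in> carrier F \<Longrightarrow> p (i x) = \<pi> x"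
    and j: "j \<in> hom F H" "\<And>x. x \<in> carrier F \<Longrightarrow> p (j x) = \<pi> x"
    and n: "n \<ge> 1" and g: "g \<in> dimension_subgroup G n"
  obtains x where "x \<in> carrier F" "\<pi> x = g"
    "inv\<^bsub>H\<^esub> (j x) \<otimes>\<^bsub>H\<^esub> i x \<in> Q_subgroup n H (kernel H G p)"
proof -
  interpret F: group F by fact
  interpret G: group G by fact
  interpret H: group H by fact
  have pi_hom: "\<pi> \<in> hom F G" and surj: "\<pi> ` carrier F = carrier G"
    using pi by (auto simp: epi_def)
  interpret pi: group_hom F G \<pi> by unfold_locales (rule pi_hom)
  interpret p: group_hom H G p by unfold_locales (rule p)
  interpret i: group_hom F H i by unfold_locales (rule i)
  interpret j: group_hom F H j by unfold_locales (rule j)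
  define S where "S = kernel H G p"
  define R where "R = kernel F G \<pi>"
  have S_iff: "s \<in> S \<longleftrightarrow> s \<in> carrier H \<and> p s = \<one>\<^bsub>G\<^esub>" for s
    by (simp add: S_def kernel_def)
  have R_iff: "r \<in> R \<longleftrightarrow> r \<in> carrier F \<and> \<pi> r = \<one>\<^bsub>G\<^esub>" for r
    by (simp add: R_def kernel_def)
  interpret S: normal S H unfolding S_def by (rule p.normal_kernel)
  interpret R: normal R F unfolding R_def by (rule pi.normal_kernel)
  define S' where "S' = derived H S"
  interpret S': normal S' H unfolding S'_def by (rule H.derived_is_normal) (rule S.normal_axioms)
  define P where "P = H Mod S'"
  define q where "q = (\<lambda>h. S' #>\<^bsub>H\<^esub> h)"
  interpret P: group P unfolding P_def by (rule S'.factorgroup_is_group)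
  have q_hom: "q \<in> hom H P" unfolding q_def P_def by (rule S'.r_coset_hom_Mod)
  interpret q: group_hom H P q by unfold_locales (rule q_hom)
  have S_comm: "q s \<otimes>\<^bsub>P\<^esub> q t = q t \<otimes>\<^bsub>P\<^esub> q s" if "s \<in> S" "t \<in> S" for s t
  proof -
    have "s \<otimes>\<^bsub>H\<^esub> t \<otimes>\<^bsub>H\<^esub> inv\<^bsub>H\<^esub> s \<otimes>\<^bsub>H\<^esub> inv\<^bsub>H\<^esub> t \<in> S'"
      unfolding S'_def derived_def using that by (auto intro!: generate.incl)
    then have "q (s \<otimes>\<^bsub>H\<^esub> t \<otimes>\<^bsub>H\<^esub> inv\<^bsub>H\<^esub> s \<otimes>\<^bsub>H\<^esub> inv\<^bsub>H\<^esub> t) = \<one>\<^bsub>P\<^esub>"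
      unfolding q_def using S'.rcos_const[OF H] by (simp add: P_def)
    moreover have "q s \<otimes>\<^bsub>P\<^esub> q t = q ((s \<otimes>\<^bsub>H\<^esub> t \<otimes>\<^bsub>H\<^esub> inv\<^bsub>H\<^esub> s \<otimes>\<^bsub>H\<^esub> inv\<^bsub>H\<^esub> t) \<otimes>\<^bsub>H\<^esub> (t \<otimes>\<^bsub>H\<^esub> s))"
      using that H.commutator_mult[of s t] q.hom_mult[of s t] S.mem_carrier by metis
    moreover note q.hom_mult[of "s \<otimes>\<^bsub>H\<^esub> t \<otimes>\<^bsub>H\<^esub> inv\<^bsub>H\<^esub> s \<otimes>\<^bsub>H\<^esub> inv\<^bsub>H\<^esub> t" "t \<otimes>\<^bsub>H\<^esub> s"]
    ultimately show ?thesis using that by (simp add: S.mem_carrier del: q.hom_mult q.hom_inv) simp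
  qed
  \<comment> \<open>\<open>?K\<close> is the abelian group S/S', kept as a subgroup of H/S' so that
    conjugation by elements of \<open>H\<close> can be expressed.\<close>
  let ?A = "q ` S"
  let ?K = "P\<lparr>carrier := ?A\<rparr>"
  have A: "subgroup ?A P" by (rule q.subgroup_img_is_subgroup[OF S.subgroup_axioms])
  interpret K: comm_group ?K
    by (rule group.group_comm_groupI[OF P.subgroup_imp_group[OF A]]) (auto simp: S_comm)
  have A_carr: "a \<in> carrier P" if "a \<in> ?A" for a using that subgroup.mem_carrier[OF A] by blast
  have K_inv: "inv\<^bsub>?K\<^esub> a = inv\<^bsub>P\<^esub> a" if "a \<in> ?A" for a
    using P.m_inv_consistent[OF A that] by simp
  define D where "D = (\<lambda>x. q (inv\<^bsub>H\<^esub> (j x) \<otimes>\<^bsub>H\<^esub> i x))"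
  define act where "act = (\<lambda>y a. q (inv\<^bsub>H\<^esub> (j y)) \<otimes>\<^bsub>P\<^esub> a \<otimes>\<^bsub>P\<^esub> q (j y))"
  have delta: "inv\<^bsub>H\<^esub> (j x) \<otimes>\<^bsub>H\<^esub> i x \<in> S" if "x \<in> carrier F" for x
    unfolding S_iff using that i(2)[OF that] j(2)[OF that] by simp
  have D_A: "D x \<in> ?A" if "x \<in> carrier F" for x
    unfolding D_def using delta[OF that] by blast
  have act_q: "act y (q s) = q (inv\<^bsub>H\<^esub> (j y) \<otimes>\<^bsub>H\<^esub> s \<otimes>\<^bsub>H\<^esub> j y)" if "y \<in> carrier F" "s \<in> carrier H" for y s
    using that by (simp add: act_def)
  have act_A: "act y a \<in> ?A" if "y \<in> carrier F" "a \<in> ?A" for y a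
  proof -
    from that obtain s where s: "s \<in> S" "a = q s" by blast
    show ?thesis
      unfolding s(2) act_q[OF that(1) S.mem_carrier[OF s(1)]]
      by (rule imageI[OF S.inv_op_closed1[OF j.hom_closed[OF that(1)] s(1)]])
  qed
  have act_hom: "act y \<in> hom ?K ?K" if "y \<in> carrier F" for y
  proof (rule homI)
    fix a b assume ab: "a \<in> carrier ?K" "b \<in> carrier ?K"
    have "q (j y) \<in> carrier P" using that by simp
    then show "act y (a \<otimes>\<^bsub>?K\<^esub> b) = act y a \<otimes>\<^bsub>?K\<^esub> act y b"
      using that ab A_carr[of a] A_carr[of b] by (simp add: act_def P.m_assoc P.inv_mult_cancel)
  qed (use act_A that in simp)
  \<comment> \<open>For y in R the element j y lies in S, and S/S' is abelian; hence the conjugation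
    action factors through \<open>G\<close>.\<close>
  have act_S: "act y a = a" if yR: "y \<in> R" and aA: "a \<in> ?A" for y a
  proof -
    have y: "y \<in> carrier F" "j y \<in> S" using yR j(2)[of y] unfolding R_iff S_iff by simp_all
    obtain s where s: "s \<in> S" "a = q s" using aA by blast
    have "a \<otimes>\<^bsub>P\<^esub> q (j y) = q (j y) \<otimes>\<^bsub>P\<^esub> a" unfolding s(2) by (rule S_comm[OF s(1) y(2)])
    then show ?thesis
      using y(1) A_carr[OF aA] by (simp add: act_def P.m_assoc P.inv_mult_cancel)
  qed
  \<comment> \<open>Insert j y and its inverse between i x and i y in inv(j y) inv(j x) i x i
    y.\<close>
  have D_mult: "D (x \<otimes>\<^bsub>F\<^esub> y) = act y (D x) \<otimes>\<^bsub>P\<^esub> D y" if "x \<in> carrier F" "y \<in> carrier F" for x y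
    using that by (simp add: D_def act_def H.inv_mult_group P.m_assoc P.inv_mult_cancel)
  have D_mult_R: "D (x \<otimes>\<^bsub>F\<^esub> r) = D x \<otimes>\<^bsub>P\<^esub> D r" if "x \<in> carrier F" "r \<in> R" for x r
    using D_mult[of x r] act_S[of r "D x"] D_A that R.mem_carrier by simp
  \<comment> \<open>Evaluate D on r y = y (inv(y) r y) in two ways and cancel D y in the abelian
    group S/S'. Consequently D(R) is stable under the action.\<close>
  have act_D_R: "act y (D r) = D (inv\<^bsub>F\<^esub> y \<otimes>\<^bsub>F\<^esub> r \<otimes>\<^bsub>F\<^esub> y)" if "y \<in> carrier F" "r \<in> R" for y r
  proof -
    let ?r = "inv\<^bsub>F\<^esub> y \<otimes>\<^bsub>F\<^esub> r \<otimes>\<^bsub>F\<^esub> y"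
    have r: "r \<in> carrier F" "?r \<in> R" "?r \<in> carrier F"
      using that R.inv_op_closed1[of y r] R.mem_carrier by auto
    have "act y (D r) \<otimes>\<^bsub>P\<^esub> D y = D (r \<otimes>\<^bsub>F\<^esub> y)" using D_mult[of r y] r that by simp
    also have "r \<otimes>\<^bsub>F\<^esub> y = y \<otimes>\<^bsub>F\<^esub> ?r" using r that by (simp add: F.m_assoc F.inv_mult_cancel)
    also have "D \<dots> = D y \<otimes>\<^bsub>P\<^esub> D ?r" by (rule D_mult_R[OF that(1) r(2)])
    also have "\<dots> = D ?r \<otimes>\<^bsub>P\<^esub> D y" using K.m_comm[of "D y" "D ?r"] D_A that r by simp
    finally show ?thesis
      using P.right_cancel[of "D y" "act y (D r)" "D ?r"] A_carr act_A D_A that r by simp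
  qed
  \<comment> \<open>The filtration will be V k = T W k: the factor T absorbs the dependence on the
    chosen preimages in \<open>F\<close>, and W k is the image of the part of S in
    \<open>lower_central H k\<close>.\<close>
  define T where "T = D ` R"
  define W where "W = (\<lambda>k. q ` (S \<inter> lower_central H k))"
  have T: "subgroup T ?K"
  proof -
    have "D \<in> hom (F\<lparr>carrier := R\<rparr>) ?K"
      by (rule homI) (use D_A D_mult_R R.mem_carrier in auto)
    then interpret DR: group_hom "F\<lparr>carrier := R\<rparr>" ?K D
      by (simp add: group_hom_def group_hom_axioms_def K.is_group F.subgroup_imp_group R.subgroup_axioms)
    show ?thesis unfolding T_def using DR.img_is_subgroup by simp
  qed
  have W: "subgroup (W k) ?K" for k
  proof -
    have "subgroup (W k) P"
      unfolding W_def
      by (rule q.subgroup_img_is_subgroup[OF H.subgroups_Inter_pair[OF S.subgroup_axioms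
              normal_imp_subgroup[OF H.normal_lower_central]]])
    then show ?thesis by (rule P.subgroup_incl[OF _ A]) (auto simp: W_def)
  qed
  define V where "V = (\<lambda>k. T <#>\<^bsub>?K\<^esub> W k)"
  have V: "subgroup (V k) ?K" for k unfolding V_def by (rule K.mult_subgroups[OF T W])
  have T_V: "t \<in> V k" if "t \<in> T" for t k
    using that subgroup.one_closed[OF W[of k]] K.r_one[of t] subgroup.mem_carrier[OF T that]
    unfolding V_def set_mult_def by force
  \<comment> \<open>A set-theoretic section of \<pi>, multiplicative only up to R.\<close>
  define \<sigma> where "\<sigma> = (\<lambda>g. SOME x. x \<in> carrier F \<and> \<pi> x = g)"
  have sigma: "\<sigma> h \<in> carrier F" "\<pi> (\<sigma> h) = h" if "h \<in> carrier G" for h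
  proof -
    have "h \<in> \<pi> ` carrier F" using that by (simp only: surj)
    then have "\<exists>x. x \<in> carrier F \<and> \<pi> x = h" by blast
    from someI_ex[OF this] show "\<sigma> h \<in> carrier F" "\<pi> (\<sigma> h) = h" by (simp_all add: \<sigma>_def)
  qed
  have "D (\<sigma> g) \<otimes>\<^bsub>?K\<^esub> inv\<^bsub>?K\<^esub> D (\<sigma> \<one>\<^bsub>G\<^esub>) \<in> V n"
  proof (rule G.derivation_dimension_subgroup[where act = "\<lambda>h. act (\<sigma> h)" and d = "\<lambda>g. D (\<sigma> g)",
        OF K.comm_group_axioms V _ act_hom _ _ _ n g])
    \<comment> \<open>The series starts with the whole of \<open>H\<close>, so W 1 already exhausts
      S/S'.\<close>
    have "?A \<subseteq> W 1" by (auto simp: W_def S.mem_carrier)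
    then have "?A \<subseteq> V 1"
      using subgroup.one_closed[OF T] K.l_one unfolding V_def set_mult_def by force
    then show "V 1 = carrier ?K" using subgroup.subset[OF V[of 1]] by auto
  next
    fix h assume "h \<in> carrier G"
    then show "\<sigma> h \<in> carrier F" "D (\<sigma> h) \<in> carrier ?K" using sigma D_A by auto
  next
    fix k h v assume k: "k \<ge> 1" and h: "h \<in> carrier G" and v: "v \<in> V k"
    let ?y = "\<sigma> h"
    have y: "?y \<in> carrier F" by (rule sigma[OF h])
    interpret act: group_hom ?K ?K "act ?y" by unfold_locales (rule act_hom[OF y])
    obtain r c where r: "r \<in> R" and c: "c \<in> S" "c \<in> lower_central H k"
      and vv: "v = D r \<otimes>\<^bsub>?K\<^esub> q c"
      using v unfolding V_def set_mult_def T_def W_def by blast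
    have carr: "r \<in> carrier F" "c \<in> carrier H" "D r \<in> ?A" "q c \<in> ?A" "j ?y \<in> carrier H"
      using r c y R.mem_carrier S.mem_carrier D_A by auto
    \<comment> \<open>The two factors of v are treated separately: the action preserves T, while on
      W it moves c by a commutator.\<close>
    have 1: "inv\<^bsub>?K\<^esub> D r \<otimes>\<^bsub>?K\<^esub> act ?y (D r) \<in> T"
      using T r act_D_R[OF y r] R.inv_op_closed1[OF y r] unfolding T_def
      by (intro subgroup.m_closed subgroup.m_inv_closed) auto
    \<comment> \<open>The element inv(c) inv(j y) c (j y) is the commutator of inv(c) and inv(j y),
      in the convention of \<open>commutator_subgroup\<close>; this raises the index by one.\<close>
    have "inv\<^bsub>?K\<^esub> q c \<otimes>\<^bsub>?K\<^esub> act ?y (q c)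
        = q (inv\<^bsub>H\<^esub> c \<otimes>\<^bsub>H\<^esub> inv\<^bsub>H\<^esub> (j ?y) \<otimes>\<^bsub>H\<^esub> inv\<^bsub>H\<^esub> (inv\<^bsub>H\<^esub> c) \<otimes>\<^bsub>H\<^esub> inv\<^bsub>H\<^esub> (inv\<^bsub>H\<^esub> (j ?y)))"
      using carr by (simp add: K_inv act_def P.m_assoc)
    moreover have "inv\<^bsub>H\<^esub> c \<otimes>\<^bsub>H\<^esub> inv\<^bsub>H\<^esub> (j ?y) \<otimes>\<^bsub>H\<^esub> inv\<^bsub>H\<^esub> (inv\<^bsub>H\<^esub> c) \<otimes>\<^bsub>H\<^esub> inv\<^bsub>H\<^esub> (inv\<^bsub>H\<^esub> (j ?y))
        \<in> lower_central H (Suc k)"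
      using carr c subgroup.m_inv_closed[OF normal_imp_subgroup[OF H.normal_lower_central]]
      by (intro H.commutator_in_lower_central[OF k]) auto
    moreover have "inv\<^bsub>H\<^esub> c \<otimes>\<^bsub>H\<^esub> inv\<^bsub>H\<^esub> (j ?y) \<otimes>\<^bsub>H\<^esub> inv\<^bsub>H\<^esub> (inv\<^bsub>H\<^esub> c) \<otimes>\<^bsub>H\<^esub> inv\<^bsub>H\<^esub> (inv\<^bsub>H\<^esub> (j ?y)) \<in> S"
      using carr c S.m_closed[OF S.m_inv_closed[OF c(1)] S.inv_op_closed1[OF carr(5) c(1)]]
      by (simp add: H.m_assoc)
    ultimately have 2: "inv\<^bsub>?K\<^esub> q c \<otimes>\<^bsub>?K\<^esub> act ?y (q c) \<in> W (Suc k)"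
      unfolding W_def by blast
    have "inv\<^bsub>?K\<^esub> v \<otimes>\<^bsub>?K\<^esub> act ?y v
        = (inv\<^bsub>?K\<^esub> D r \<otimes>\<^bsub>?K\<^esub> act ?y (D r)) \<otimes>\<^bsub>?K\<^esub> (inv\<^bsub>?K\<^esub> q c \<otimes>\<^bsub>?K\<^esub> act ?y (q c))"
    proof -
      have K: "D r \<in> carrier ?K" "q c \<in> carrier ?K" using carr by auto
      show ?thesis
        unfolding vv act.hom_mult[OF K] K.inv_mult[OF K]
        using K act.hom_closed[OF K(1)] act.hom_closed[OF K(2)] K.inv_closed[OF K(1)] K.inv_closed[OF K(2)]
        by (simp only: K.m_ac K.m_closed)
    qed
    then show "inv\<^bsub>?K\<^esub> v \<otimes>\<^bsub>?K\<^esub> act ?y v \<in> V (Suc k)"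
      using 1 2 unfolding V_def set_mult_def by blast
  next
    fix k g h assume gh: "g \<in> carrier G" "h \<in> carrier G"
    let ?x = "\<sigma> g" and ?y = "\<sigma> h" and ?z = "\<sigma> (g \<otimes>\<^bsub>G\<^esub> h)"
    have xyz: "?x \<in> carrier F" "?y \<in> carrier F" "?z \<in> carrier F" using gh sigma by auto
    \<comment> \<open>The failure of the section to be multiplicative is an element of R. Expanding
      D on x y = z r shows that the cocycle defect is exactly D r, which lies in T and thus in every
      V k.\<close>
    let ?r = "inv\<^bsub>F\<^esub> ?z \<otimes>\<^bsub>F\<^esub> (?x \<otimes>\<^bsub>F\<^esub> ?y)"
    have r: "?r \<in> R" unfolding R_iff using xyz gh by (simp add: sigma)
    have "act ?y (D ?x) \<otimes>\<^bsub>P\<^esub> D ?y = D (?z \<otimes>\<^bsub>F\<^esub> ?r)"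
      using xyz by (simp add: D_mult F.inv_mult_cancel)
    also have "\<dots> = D ?z \<otimes>\<^bsub>P\<^esub> D ?r" by (rule D_mult_R[OF xyz(3) r])
    finally have "inv\<^bsub>?K\<^esub> D ?z \<otimes>\<^bsub>?K\<^esub> (act ?y (D ?x) \<otimes>\<^bsub>?K\<^esub> D ?y) = D ?r"
      using K_inv[OF D_A[OF xyz(3)]] A_carr[OF D_A[OF xyz(3)]] A_carr[OF D_A[OF R.mem_carrier[OF r]]]
      by (simp add: P.inv_mult_cancel)
    then show "inv\<^bsub>?K\<^esub> D ?z \<otimes>\<^bsub>?K\<^esub> (act ?y (D ?x) \<otimes>\<^bsub>?K\<^esub> D ?y) \<in> V k"
      using T_V[of _ k] r by (simp add: T_def)
  qed
  moreover have "\<sigma> \<one>\<^bsub>G\<^esub> \<in> R" unfolding R_iff using sigma[OF G.one_closed] by simp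
  then have "D (\<sigma> \<one>\<^bsub>G\<^esub>) \<in> V n" using T_V by (simp add: T_def)
  ultimately have "(D (\<sigma> g) \<otimes>\<^bsub>?K\<^esub> inv\<^bsub>?K\<^esub> D (\<sigma> \<one>\<^bsub>G\<^esub>)) \<otimes>\<^bsub>?K\<^esub> D (\<sigma> \<one>\<^bsub>G\<^esub>) \<in> V n"
    using subgroup.m_closed[OF V] by blast
  moreover have gG: "g \<in> carrier G" using g by (simp add: dimension_subgroup_def)
  moreover have "D (\<sigma> g) \<in> carrier ?K" "D (\<sigma> \<one>\<^bsub>G\<^esub>) \<in> carrier ?K"
    using sigma(1)[OF gG] sigma(1)[OF G.one_closed] D_A by auto
  ultimately have "D (\<sigma> g) \<in> V n" using K.m_assoc K.l_inv K.r_one K.inv_closed by metis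
  then obtain r c where r: "r \<in> R" and c: "c \<in> S" "c \<in> lower_central H n"
    and Dg: "D (\<sigma> g) = D r \<otimes>\<^bsub>P\<^esub> q c"
    unfolding V_def set_mult_def T_def W_def by auto
  \<comment> \<open>Dividing by r leaves the image in \<open>G\<close> unchanged and, by
    \<open>D_mult_R\<close>, removes the factor D r, so that D x = q c.\<close>
  define x where "x = \<sigma> g \<otimes>\<^bsub>F\<^esub> inv\<^bsub>F\<^esub> r"
  have rF: "r \<in> carrier F" "inv\<^bsub>F\<^esub> r \<in> R" using r by (simp_all add: R.mem_carrier R.m_inv_closed)
  have x: "x \<in> carrier F" "\<pi> x = g"
    using sigma[OF gG] rF(1) r gG unfolding x_def R_iff by simp_all
  have "D x \<otimes>\<^bsub>P\<^esub> D r = D (\<sigma> g)"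
    using D_mult_R[OF x(1) r] sigma[OF gG] rF by (simp add: x_def F.m_assoc)
  also have "\<dots> = q c \<otimes>\<^bsub>P\<^esub> D r"
    unfolding Dg using K.m_comm[of "D r" "q c"] D_A[OF rF(1)] c by simp
  finally have "D x = q c"
    using P.right_cancel[of "D r" "D x" "q c"] A_carr D_A x(1) rF(1) c by simp
  then have "S' #>\<^bsub>H\<^esub> (inv\<^bsub>H\<^esub> (j x) \<otimes>\<^bsub>H\<^esub> i x) = S' #>\<^bsub>H\<^esub> c" by (simp add: D_def q_def)
  then have "inv\<^bsub>H\<^esub> (j x) \<otimes>\<^bsub>H\<^esub> i x \<in> S' #>\<^bsub>H\<^esub> c"
    using H.rcos_self[OF _ S'.subgroup_axioms, of "inv\<^bsub>H\<^esub> (j x) \<otimes>\<^bsub>H\<^esub> i x"] x(1) by simp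
  then have "inv\<^bsub>H\<^esub> (j x) \<otimes>\<^bsub>H\<^esub> i x \<in> Q_subgroup n H S"
    using c(2) unfolding Q_subgroup_def set_mult_def r_coset_def S'_def by blast
  with x show thesis using that unfolding S_def by blast
qed

section \<open>Comparison of the two subgroups of G/\<gamma>_n(G)\<close>

theorem mainTheorem2:
  fixes G :: "'g monoid" and F :: "'f monoid"
    and R :: "'f set" and \<pi> :: "'f \<Rightarrow> 'g" and n :: nat
  assumes "group G"
    and "n \<ge> 1"
    and "free_presentation G F R \<pi>"
  shows
    "let H = free_product F F;
         S = kernel H G (free_product_lift G \<pi> \<pi>);
         i\<^sub>0 = free_product_inl F F;
         i\<^sub>1 = free_product_inr F F;
         Eq = equalizer (Q_group n F R) (Q_map n H S i\<^sub>0) (Q_map n H S i\<^sub>1);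
         Im = quotient_map G (lower_central G n) \<pi> ` Eq
     in (G\<lparr>carrier := dimension_subgroup G n\<rparr>) Mod lower_central G n
          \<cong> (G Mod lower_central G n)\<lparr>carrier := Im\<rparr>"
proof -
  interpret G: group G by fact
  have F: "group F" and pi: "\<pi> \<in> epi F G" and R: "R = kernel F G \<pi>"
    using assms(3) by (auto simp: free_presentation_def free_group_def)
  interpret F: group F by fact
  have pi_hom: "\<pi> \<in> hom F G" using pi by (simp add: epi_def)
  interpret pi: group_hom F G \<pi> by unfold_locales (rule pi_hom)
  define H where "H = free_product F F"
  define i where "i = free_product_inl F F"
  define j where "j = free_product_inr F F"
  define p where "p = free_product_lift G \<pi> \<pi>"
  define S where "S = kernel H G p"
  interpret H: group H unfolding H_def by (rule group_free_product[OF F F])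
  interpret p: group_hom H G p
    by unfold_locales (unfold H_def p_def, rule free_product_lift_hom[OF F F G.is_group pi_hom pi_hom])
  interpret i: group_hom F H i
    by unfold_locales (unfold H_def i_def, rule free_product_inl_hom[OF F F])
  interpret j: group_hom F H j
    by unfold_locales (unfold H_def j_def, rule free_product_inr_hom[OF F F])
  have pij: "p (i x) = \<pi> x" "p (j x) = \<pi> x" if "x \<in> carrier F" for x
    using that free_product_lift_inl[OF F F G.is_group pi_hom pi_hom]
      free_product_lift_inr[OF F F G.is_group pi_hom pi_hom]
    by (simp_all add: p_def i_def j_def)
  let ?L = "lower_central G n" and ?M = "Q_subgroup n F R" and ?N = "Q_subgroup n H S"
  let ?Eq = "equalizer (Q_group n F R) (Q_map n H S i) (Q_map n H S j)"
  have L: "?L \<lhd> G" by (rule G.normal_lower_central)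
  have M: "?M \<lhd> F" unfolding R by (rule F.normal_Q_subgroup[OF pi.normal_kernel])
  have N: "?N \<lhd> H" unfolding S_def by (rule H.normal_Q_subgroup[OF p.normal_kernel])
  interpret N: normal ?N H by fact
  have RF: "R \<subseteq> carrier F" and iR: "i ` R \<subseteq> S" and jR: "j ` R \<subseteq> S"
    using pij by (auto simp: R S_def kernel_def)
  have Qi: "Q_map n H S i (?M #>\<^bsub>F\<^esub> x) = ?N #>\<^bsub>H\<^esub> i x"
    and Qj: "Q_map n H S j (?M #>\<^bsub>F\<^esub> x) = ?N #>\<^bsub>H\<^esub> j x" if "x \<in> carrier F" for x
    unfolding Q_map_def
    by (rule i.quotient_map_r_coset[OF N M i.hom_Q_subgroup[OF assms(2) RF iR] that],
        rule j.quotient_map_r_coset[OF N M j.hom_Q_subgroup[OF assms(2) RF jR] that])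
  \<comment> \<open>Since \<pi> maps R to the trivial subgroup, \<open>hom_Q_subgroup\<close>
    applies with that subgroup in the role of S; its derived subgroup is trivial, so only
    \<open>lower_central G n\<close> is left.\<close>
  have "\<pi> ` ?M \<subseteq> Q_subgroup n G {\<one>\<^bsub>G\<^esub>}"
    by (rule pi.hom_Q_subgroup[OF assms(2) RF]) (auto simp: R kernel_def)
  moreover have "Q_subgroup n G {\<one>\<^bsub>G\<^esub>} \<subseteq> ?L"
    using G.derived_subset_one[of "{\<one>\<^bsub>G\<^esub>}"] subgroup.subset[OF normal_imp_subgroup[OF L]]
    by (auto simp: Q_subgroup_def set_mult_def subset_iff)
  ultimately have "\<pi> ` ?M \<subseteq> ?L" by (rule subset_trans)
  then have Qpi: "quotient_map G ?L \<pi> (?M #>\<^bsub>F\<^esub> x) = ?L #>\<^bsub>G\<^esub> \<pi> x" if "x \<in> carrier F" for x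
    by (rule pi.quotient_map_r_coset[OF L M _ that])
  have coset_eq: "?N #>\<^bsub>H\<^esub> u = ?N #>\<^bsub>H\<^esub> v \<longleftrightarrow> u \<otimes>\<^bsub>H\<^esub> inv\<^bsub>H\<^esub> v \<in> ?N"
    if "u \<in> carrier H" "v \<in> carrier H" for u v
    using that N.rcos_module[OF H.is_group, of v u] H.rcos_self[OF _ N.subgroup_axioms, of u]
      H.repr_independence[OF _ _ N.subgroup_axioms, of u v] by metis
  \<comment> \<open>Both sides of the theorem are thereby carried by the same set of cosets, and the
    isomorphism becomes an equality of groups.\<close>
  have Im: "quotient_map G ?L \<pi> ` ?Eq = (\<lambda>g. ?L #>\<^bsub>G\<^esub> g) ` dimension_subgroup G n"
  proof (intro equalityI subsetI)
    fix C assume "C \<in> quotient_map G ?L \<pi> ` ?Eq"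
    then obtain x where x: "x \<in> carrier F" "Q_map n H S i (?M #>\<^bsub>F\<^esub> x) = Q_map n H S j (?M #>\<^bsub>F\<^esub> x)"
      and C: "C = quotient_map G ?L \<pi> (?M #>\<^bsub>F\<^esub> x)"
      by (auto simp: equalizer_def Q_group_def FactGroup_def RCOSETS_def)
    have "i x \<otimes>\<^bsub>H\<^esub> inv\<^bsub>H\<^esub> (j x) \<in> ?N" using x coset_eq by (simp add: Qi Qj)
    then have "\<pi> x \<in> dimension_subgroup G n"
      using G.free_product_equalizer_imp_dimension_subgroup[OF F pi_hom assms(2) x(1)]
      by (simp add: H_def S_def p_def i_def j_def)
    then show "C \<in> (\<lambda>g. ?L #>\<^bsub>G\<^esub> g) ` dimension_subgroup G n"
      using Qpi[OF x(1)] C by blast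
  next
    fix C assume "C \<in> (\<lambda>g. ?L #>\<^bsub>G\<^esub> g) ` dimension_subgroup G n"
    then obtain g where g: "g \<in> dimension_subgroup G n" and C: "C = ?L #>\<^bsub>G\<^esub> g" by blast
    obtain x where x: "x \<in> carrier F" "\<pi> x = g" "inv\<^bsub>H\<^esub> (j x) \<otimes>\<^bsub>H\<^esub> i x \<in> ?N"
      using dimension_subgroup_lift[OF F G.is_group H.is_group pi p.homh i.homh _ j.homh _ assms(2) g]
        pij unfolding S_def by metis
    \<comment> \<open>Conjugation by j x turns the left quotient inv(j x) i x into the right
      quotient i x inv(j x), which is what equality of right cosets requires.\<close>
    have "j x \<otimes>\<^bsub>H\<^esub> (inv\<^bsub>H\<^esub> (j x) \<otimes>\<^bsub>H\<^esub> i x) \<otimes>\<^bsub>H\<^esub> inv\<^bsub>H\<^esub> (j x) \<in> ?N"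
      using x(1) by (intro N.inv_op_closed2[OF _ x(3)]) simp
    then have "i x \<otimes>\<^bsub>H\<^esub> inv\<^bsub>H\<^esub> (j x) \<in> ?N" using x(1) by (simp add: H.inv_mult_cancel)
    then have "?M #>\<^bsub>F\<^esub> x \<in> ?Eq"
      using x(1) coset_eq
      by (auto simp: equalizer_def Q_group_def FactGroup_def RCOSETS_def Qi Qj)
    then show "C \<in> quotient_map G ?L \<pi> ` ?Eq" using Qpi[OF x(1)] x(2) C by blast
  qed
  \<comment> \<open>Products of sets and right cosets depend only on the multiplication, so
    restricting the carrier before or after forming the quotient gives the same operation.\<close>
  have "set_mult (G\<lparr>carrier := dimension_subgroup G n\<rparr>) = set_mult G"
    by (intro ext) (simp add: set_mult_def)
  then have "(G\<lparr>carrier := dimension_subgroup G n\<rparr>) Mod ?L = (G Mod ?L)\<lparr>carrier := quotient_map G ?L \<pi> ` ?Eq\<rparr>"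
    unfolding Im by (auto simp: FactGroup_def RCOSETS_def r_coset_def)
  then show ?thesis
    unfolding Let_def by (simp add: H_def S_def p_def i_def j_def)
qed

end
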